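(* Assume that $Z_{0,\ell}=0$ for all $\ell\in\{1,\dots,L\}$. Then for each $n\in\mathbb{N}$, the sequence $(V_{n-1}^n,V_{n-2}^n,\dots,V_0^n)$ has the same distribution as $(Z_0,Z_1,\dots,Z_{n-1})$.
   Context: Let $M,L\ge 1$ be integers, $\Lambda=\{-L,-L+1,\dots,-1,1\}$, and let $\nu,q_1,\dots,q_M$ be probability measures on $\Lambda$ such that $\nu$ has zero mean and, for each $j\in\{1,\dots,M\}$, $q_j$ has positive mean and $q_j(1)<1$. Define $\omega(j,i)=q_j(i)$ if $1\le j\le M$ and $\omega(j,i)=\nu(i)$ if $j>M$. The $(L,1)$-excited random walk is the $\mathbb{Z}$-valued process $\mathbf{X}=(X_n)_{n\ge0}$ with $X_0=0$ and $\mathbb{P}(X_{n+1}=X_n+i\mid\mathcal{F}_n)=\omega(\mathcal{L}(X_n,n),i)$, $i\in\Lambda$, where $(\mathcal{F}_n)$ is its natural filtration and $\mathcal{L}(x,n)=\sum_{k=0}^n\mathbf{1}_{\{X_k=x\}}$. Standing assumption: $\mathbf{X}$ is transient to the right ($X_n\to+\infty$ almost surely). For $n\ge0$ let $T_n=\inf\{k\ge0:X_k=n\}$. For $i\le n-1$ let $V_i^n=(V_{i,1}^n,\dots,V_{i,L}^n)$ with $V_{i,\ell}^n=\sum_{k=0}^{T_n-1}\mathbf{1}_{\{X_k>i,\ X_{k+1}=i-\ell+1\}}$. Let $(\xi_n)_{n\in\mathbb{N}}$, $\xi_n=(\xi_{n,1},\dots,\xi_{n,L+1})$, be independent random vectors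 taking values in the standard basis $\mathbf{e}_1,\dots,\mathbf{e}_{L+1}$ of $\mathbb{R}^{L+1}$, with: for $1\le n\le M$, $\mathbb{P}(\xi_n=\mathbf{e}_\ell)=q_n(-\ell)$ for $1\le\ell\le L$ and $\mathbb{P}(\xi_n=\mathbf{e}_{L+1})=q_n(1)$; for $n>M$, $\mathbb{P}(\xi_n=\mathbf{e}_\ell)=\nu(-\ell)$ for $1\le\ell\le L$ and $\mathbb{P}(\xi_n=\mathbf{e}_{L+1})=\nu(1)$. For $m\in\mathbb{Z}_+$ let $\gamma_m=\inf\{n\ge1:\sum_{i=1}^n\xi_{i,L+1}=m+1\}$ and $A(m)=(A_1(m),\dots,A_L(m))$ with $A_\ell(m)=\sum_{i=1}^{\gamma_m}\xi_{i,\ell}$. Let $(A^{(n)}(m))_{m\in\mathbb{Z}_+}$, $n\in\mathbb{N}$, be i.i.d. copies of the process $(A(m))_{m\in\mathbb{Z}_+}$. The process $\mathbf{Z}=(Z_n)_{n\ge0}$, $Z_n=(Z_{n,1},\dots,Z_{n,L})\in\mathbb{Z}_+^L$, is defined by $Z_0$ independent of $(A^{(n)}(m))_{n\in\mathbb{N},m\in\mathbb{Z}_+}$ and, for $n\ge1$, $Z_n=A^{(n)}(|Z_{n-1}|)+(Z_{n-1,2},Z_{n-1,3},\dots,Z_{n-1,L},0)$, where $|z|=z_1+\dots+z_L$. *)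

theory Defs
  imports "HOL-Probability.Probability"
begin

text \<open>
  Vectors indexed by \<open>1, \<dots>, d\<close> are extensional functions on \<open>{1..d}\<close>, so that all indices
  below are those of the mathematical text.
\<close>

definition vec_space :: "nat \<Rightarrow> (nat \<Rightarrow> nat) measure" where
  "vec_space d = (\<Pi>\<^sub>M l\<in>{1..d}. count_space UNIV)"

definition proc_space :: "nat \<Rightarrow> (nat \<Rightarrow> nat \<Rightarrow> nat) measure" where
  "proc_space d = (\<Pi>\<^sub>M m\<in>UNIV. vec_space d)"

definition basis_vec :: "nat \<Rightarrow> nat \<Rightarrow> nat \<Rightarrow> nat" where
  "basis_vec d l = (\<lambda>l'\<in>{1..d}. if l' = l then 1 else 0)"

definition vec_norm :: "nat \<Rightarrow> (nat \<Rightarrow> nat) \<Rightarrow> nat" where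
  "vec_norm d z = (\<Sum>l\<in>{1..d}. z l)"

definition steps :: "nat \<Rightarrow> int set" where
  "steps L = {- int L..-1} \<union> {1}"

text \<open>Only arguments \<open>j \<ge> 1\<close> are meaningful; \<open>q 0\<close> is never used.\<close>

definition env :: "nat \<Rightarrow> (nat \<Rightarrow> int pmf) \<Rightarrow> int pmf \<Rightarrow> nat \<Rightarrow> int pmf" where
  "env M q \<nu> j = (if j \<le> M then q j else \<nu>)"

definition visits :: "(nat \<Rightarrow> 'a \<Rightarrow> int) \<Rightarrow> int \<Rightarrow> nat \<Rightarrow> 'a \<Rightarrow> nat" where
  "visits X x n w = (\<Sum>k\<in>{0..n}. of_bool (X k w = x))"

definition nat_filtration :: "'a measure \<Rightarrow> (nat \<Rightarrow> 'a \<Rightarrow> int) \<Rightarrow> nat \<Rightarrow> 'a measure" where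
  "nat_filtration P X n = sigma (space P) {X k -` B \<inter> space P | k B. k \<le> n}"

definition excited_random_walk ::
  "'a measure \<Rightarrow> nat \<Rightarrow> nat \<Rightarrow> (nat \<Rightarrow> int pmf) \<Rightarrow> int pmf \<Rightarrow> (nat \<Rightarrow> 'a \<Rightarrow> int) \<Rightarrow> bool" where
  "excited_random_walk P L M q \<nu> X \<longleftrightarrow>
     prob_space P \<and>
     (\<forall>n. X n \<in> measurable P (count_space UNIV)) \<and>
     (AE w in P. X 0 w = 0) \<and>
     (\<forall>n. \<forall>i\<in>steps L. AE w in P.
        real_cond_exp P (nat_filtration P X n) (\<lambda>w'. of_bool (X (Suc n) w' = X n w' + i)) w
          = pmf (env M q \<nu> (visits X (X n w) n w)) i)"

text \<open>
  A hitting time is \<open>\<infinity>\<close> if the level is never reached.  On such paths (a null set for a walk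
  transient to the right, whose upward steps are all \<open>1\<close>) the index set in \<open>down_jumps\<close> is
  infinite and the sum is \<open>0\<close> by convention.
\<close>

definition hit_time :: "(nat \<Rightarrow> 'a \<Rightarrow> int) \<Rightarrow> nat \<Rightarrow> 'a \<Rightarrow> enat" where
  "hit_time X n w = Inf {enat k | k. X k w = int n}"

definition down_jumps ::
  "nat \<Rightarrow> (nat \<Rightarrow> 'a \<Rightarrow> int) \<Rightarrow> nat \<Rightarrow> int \<Rightarrow> 'a \<Rightarrow> nat \<Rightarrow> nat" where
  "down_jumps L X n i w =
     (\<lambda>l\<in>{1..L}. \<Sum>k\<in>{k. enat k < hit_time X n w}.
        of_bool (X k w > i \<and> X (Suc k) w = i - int l + 1))"

definition reward_sequence ::
  "'b measure \<Rightarrow> nat \<Rightarrow> nat \<Rightarrow> (nat \<Rightarrow> int pmf) \<Rightarrow> int pmf \<Rightarrow> (nat \<Rightarrow> 'b \<Rightarrow> nat \<Rightarrow> nat) \<Rightarrow> bool"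
where
  "reward_sequence Q L M q \<nu> \<xi> \<longleftrightarrow>
     prob_space Q \<and>
     prob_space.indep_vars Q (\<lambda>n. vec_space (L + 1)) \<xi> {1..} \<and>
     (\<forall>n\<ge>1. \<forall>w\<in>space Q. \<xi> n w \<in> basis_vec (L + 1) ` {1..L + 1}) \<and>
     (\<forall>n\<ge>1. \<forall>l\<in>{1..L}.
        measure Q {w \<in> space Q. \<xi> n w = basis_vec (L + 1) l} = pmf (env M q \<nu> n) (- int l)) \<and>
     (\<forall>n\<ge>1.
        measure Q {w \<in> space Q. \<xi> n w = basis_vec (L + 1) (L + 1)} = pmf (env M q \<nu> n) 1)"

text \<open>
  Again \<open>stop_index\<close> is \<open>\<infinity>\<close> only on a null set, since \<open>\<nu>\<close> has mean zero and hence \<open>pmf \<nu> 1 > 0\<close>;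
  there the sum in \<open>reward_process\<close> is \<open>0\<close> by convention.
\<close>

definition stop_index :: "nat \<Rightarrow> (nat \<Rightarrow> 'b \<Rightarrow> nat \<Rightarrow> nat) \<Rightarrow> nat \<Rightarrow> 'b \<Rightarrow> enat" where
  "stop_index L \<xi> m w = Inf {enat n | n. n \<ge> 1 \<and> (\<Sum>i\<in>{1..n}. \<xi> i w (L + 1)) = m + 1}"

definition reward_process ::
  "nat \<Rightarrow> (nat \<Rightarrow> 'b \<Rightarrow> nat \<Rightarrow> nat) \<Rightarrow> 'b \<Rightarrow> nat \<Rightarrow> nat \<Rightarrow> nat" where
  "reward_process L \<xi> w m =
     (\<lambda>l\<in>{1..L}. \<Sum>i\<in>{i. 1 \<le> i \<and> enat i \<le> stop_index L \<xi> m w}. \<xi> i w l)"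

definition iid_copies ::
  "'c measure \<Rightarrow> nat \<Rightarrow> (nat \<Rightarrow> nat \<Rightarrow> nat) measure \<Rightarrow> (nat \<Rightarrow> 'c \<Rightarrow> nat \<Rightarrow> nat \<Rightarrow> nat) \<Rightarrow> bool" where
  "iid_copies R L \<mu> A \<longleftrightarrow>
     prob_space.indep_vars R (\<lambda>n. proc_space L) A {1..} \<and>
     (\<forall>n\<ge>1. distr R (proc_space L) (A n) = \<mu>)"

text \<open>
  Independence of an initial vector from the whole family is expressed through the generated
  sigma-algebras, since \<open>indep_var\<close> requires both variables to have the same value type.
\<close>

definition indep_initial ::
  "'c measure \<Rightarrow> nat \<Rightarrow> ('c \<Rightarrow> nat \<Rightarrow> nat) \<Rightarrow> (nat \<Rightarrow> 'c \<Rightarrow> nat \<Rightarrow> nat \<Rightarrow> nat) \<Rightarrow> bool" where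
  "indep_initial R L Z0 A \<longleftrightarrow>
     Z0 \<in> measurable R (vec_space L) \<and>
     prob_space.indep_set R
       (sets (vimage_algebra (space R) Z0 (vec_space L)))
       (sets (vimage_algebra (space R) (\<lambda>w. \<lambda>n\<in>{1..}. A n w)
          (\<Pi>\<^sub>M n\<in>{1..}. proc_space L)))"

primrec branching_process ::
  "nat \<Rightarrow> ('c \<Rightarrow> nat \<Rightarrow> nat) \<Rightarrow> (nat \<Rightarrow> 'c \<Rightarrow> nat \<Rightarrow> nat \<Rightarrow> nat) \<Rightarrow> nat \<Rightarrow> 'c \<Rightarrow> nat \<Rightarrow> nat" where
  "branching_process L Z0 A 0 w = Z0 w"
| "branching_process L Z0 A (Suc n) w =
     (\<lambda>l\<in>{1..L}. A (Suc n) w (vec_norm L (branching_process L Z0 A n w)) l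
        + (if l < L then branching_process L Z0 A n w (l + 1) else 0))"

end

theory Submission
  imports Defs "HOL-Library.Sublist"
begin

text \<open>
Write \<open>\<omega> j\<close> for the law of the step taken at the \<open>j\<close>-th visit to a site, and fix a path from \<open>0\<close>
that first reaches \<open>n\<close> at time \<open>T\<close>. Upward steps have length one, so every site \<open>x\<close> with
\<open>0 \<le> x < n\<close> is crossed upwards exactly once more than it is crossed downwards. With \<open>V x\<close> the vector
of downward crossings of \<open>x\<close>, sorted by overshoot, this says that the word of all steps taken from
\<open>x\<close> before \<open>T\<close> contains \<open>|V x| + 1\<close> upward steps, the last letter being one of them. A downward
crossing of \<open>x - 1\<close> either starts at \<open>x\<close>, and is then a letter of that word, or comes from above and
is also counted by \<open>V x\<close>, one place further on. Hence \<open>V (x - 1)\<close> is computed from \<open>V x\<close> and the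
word at \<open>x\<close> exactly as \<open>Z (k + 1)\<close> is computed from \<open>Z k\<close> and a reward sequence stopped at its
\<open>(|Z k| + 1)\<close>-st upward step. Moreover \<open>V (n - 1) = 0 = Z 0\<close>.

It remains to see that the words at the sites \<open>1, \<dots>, n - 1\<close> behave like independent stopped
reward sequences. This is seen without coupling, from a martingale.
Prescribe crossing vectors \<open>z 0 = 0, z 1, \<dots>\<close> and, at each of these sites, a word \<open>d x\<close> that leads from
one vector to the next, and let \<open>M t\<close> be the product over \<open>x\<close> of the following factor:
\<open>0\<close> if the steps taken from \<open>x\<close> before time \<open>t\<close> contradict \<open>d x\<close>, and otherwise the product of
the \<open>\<omega>\<close>-probabilities of those letters of \<open>d x\<close> that have not yet been used. A step of the walk
uses one letter of one word, and the probability of the correct letter is precisely the factor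
that disappears; so \<open>M\<close> has constant expectation (\<open>expectation_likelihood\<close>). Words stopped at the
\<open>m\<close>-th upward step form a prefix code. By transience \<open>n\<close> is hit, and from then on \<open>M\<close> is the
indicator of the event that the words before \<open>T\<close> are the prescribed ones
(\<open>sum_completion_weights_eq_indicator\<close>). Dominated convergence gives the probability of that event
as a product of letter probabilities, and summing over all words that lead from \<open>z (k - 1)\<close> to
\<open>z k\<close> gives \<open>prob_down_jumps\<close>: the probability of \<open>V = z\<close> is a product of one-step weights.

Summing the same letter probabilities over the same prefix code gives the law of one reward vector
(\<open>prob_reward_event\<close>), so by independence of the copies the branching process has the same
product formula (\<open>prob_branching_process\<close>). As both sequences live in a countable
space, agreement on points is agreement of laws.
\<close>

section \<open>Words of steps stopped at an upward step\<close>

text \<open>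
The letters of \<open>d\<close> beyond position \<open>length u\<close> are the ones still to be used once \<open>u\<close> has been read.
If \<open>u\<close> is already longer than \<open>d\<close>, nothing remains and the empty product gives \<open>1\<close>. List positions
start at \<open>0\<close> and visits at \<open>1\<close>, whence \<open>Suc j\<close>.
\<close>

definition completion_weight :: "(nat \<Rightarrow> int pmf) \<Rightarrow> int list \<Rightarrow> int list \<Rightarrow> real" where
  "completion_weight p d u =
     (if prefix u d \<or> prefix d u then \<Prod>j\<in>{length u..<length d}. pmf (p (Suc j)) (d ! j) else 0)"

lemma completion_weight_nonneg: "0 \<le> completion_weight p d u"
  by (simp add: completion_weight_def prod_nonneg)

lemma completion_weight_le_1: "completion_weight p d u \<le> 1"
  by (simp add: completion_weight_def prod_le_1 pmf_le_1)

lemma completion_weight_Nil: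
  "completion_weight p d [] = (\<Prod>j<length d. pmf (p (Suc j)) (d ! j))"
  by (simp add: completion_weight_def atLeast0LessThan)

text \<open>
The source of the martingale property. While \<open>u\<close> is a proper prefix of \<open>d\<close> only the next letter of
\<open>d\<close> keeps the weight positive, and its probability is the factor that the longer prefix no longer
carries. In all other cases the weight does not change with another letter and the probabilities
add up to one.
\<close>

lemma completion_weight_average:
  assumes S: "finite S" "set_pmf (p (Suc (length u))) \<subseteq> S"
  shows "(\<Sum>i\<in>S. pmf (p (Suc (length u))) i * completion_weight p d (u @ [i])) = completion_weight p d u"
proof (cases "prefix d u")
  case True
  then have "length d \<le> length u" by (rule prefix_length_le)
  with True have "completion_weight p d (u @ [i]) = 1" "completion_weight p d u = 1" for i
    by (auto simp: completion_weight_def)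
  then show ?thesis using sum_pmf_eq_1[OF S] by simp
next
  case notdu: False
  show ?thesis
  proof (cases "prefix u d")
    case False
    have "\<not> prefix (u @ [i]) d" for i using False append_prefixD by blast
    moreover have "\<not> prefix d (u @ [i])" for i using False notdu by auto
    ultimately show ?thesis using False notdu by (simp add: completion_weight_def)
  next
    case True
    then obtain r where r: "d = u @ r" by (auto elim: prefixE)
    with notdu obtain a r' where d: "d = u @ a # r'" by (cases r) auto
    let ?p = "p (Suc (length u))"
    have "pmf ?p i * completion_weight p d (u @ [i]) = (if i = a then completion_weight p d u else 0)" for i
    proof (cases "i = a")
      case True
      have "{length u..<length d} = insert (length u) {Suc (length u)..<length d}" using d by auto
      then show ?thesis using True d by (simp add: completion_weight_def)
    next
      case False
      then show ?thesis using d by (simp add: completion_weight_def)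
    qed
    moreover have "completion_weight p d u = 0" if "a \<notin> S"
    proof -
      have "pmf ?p (d ! length u) = 0" using that S(2) d by (auto simp: set_pmf_iff)
      moreover have "length u \<in> {length u..<length d}" using d by auto
      ultimately show ?thesis unfolding completion_weight_def
        by (metis finite_atLeastLessThan prod_zero_iff)
    qed
    ultimately show ?thesis using S(1) by (simp add: sum.delta')
  qed
qed

text \<open>
The step words that turn the crossing vector \<open>z\<close> at a site into the vector \<open>z'\<close> at the site below.
The count of \<open>1\<close> excludes the empty word, for which \<open>last\<close> would be unspecified.
\<close>

definition stopped_words :: "nat \<Rightarrow> (nat \<Rightarrow> nat) \<Rightarrow> (nat \<Rightarrow> nat) \<Rightarrow> int list set" where
  "stopped_words L z z' = {d. set d \<subseteq> steps L \<and> last d = 1 \<and> count_list d 1 = vec_norm L z + 1 \<and>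
     (\<forall>l\<in>{1..L}. count_list d (- int l) + (if l < L then z (l + 1) else 0) = z' l)}"

lemma finite_steps [simp]: "finite (steps L)"
  by (simp add: steps_def)

lemma sum_steps: "(\<Sum>i\<in>steps L. f i) = f 1 + (\<Sum>l\<in>{1..L}. f (- int l))"
proof -
  have "{- int L..-1} = (\<lambda>l. - int l) ` {1..L}"
  proof (intro set_eqI iffI)
    fix i assume "i \<in> {- int L..-1}"
    then show "i \<in> (\<lambda>l. - int l) ` {1..L}" by (intro image_eqI[where x = "nat (- i)"]) auto
  qed auto
  then have "(\<Sum>i\<in>{- int L..-1}. f i) = (\<Sum>l\<in>{1..L}. f (- int l))"
    by (simp add: sum.reindex inj_on_def)
  moreover have "(\<Sum>i\<in>steps L. f i) = (\<Sum>i\<in>{- int L..-1}. f i) + f 1"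
    unfolding steps_def by (subst sum.union_disjoint) auto
  ultimately show ?thesis by (simp add: add.commute)
qed

text \<open>
The length of a word is the number of its upward steps plus the number of its downward steps, and
the latter is at most \<open>vec_norm L z'\<close>.
\<close>

lemma finite_stopped_words: "finite (stopped_words L z z')"
proof (rule finite_subset)
  show "stopped_words L z z' \<subseteq> {d. set d \<subseteq> steps L \<and> length d \<le> vec_norm L z + 1 + vec_norm L z'}"
  proof safe
    fix d assume d: "d \<in> stopped_words L z z'"
    then show "x \<in> set d \<Longrightarrow> x \<in> steps L" for x by (auto simp: stopped_words_def)
    have "length d = (\<Sum>i\<in>steps L. count_list d i)"
      using d by (intro sum_count_set[symmetric]) (auto simp: stopped_words_def)
    also have "\<dots> \<le> vec_norm L z + 1 + vec_norm L z'"
      unfolding sum_steps using d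
      by (auto simp: stopped_words_def vec_norm_def intro!: sum_mono)
    finally show "length d \<le> vec_norm L z + 1 + vec_norm L z'" .
  qed
qed (rule finite_lists_length_le, simp)

text \<open>
The prefix-code property: a proper extension would end in one upward step more. The targets \<open>a\<close>
and \<open>b\<close> may differ, because a stopping rule sees only the number of upward steps.
\<close>

lemma stopped_words_prefix_eq:
  assumes "c \<in> stopped_words L z a" "d \<in> stopped_words L z b" "prefix c d"
  shows "c = d"
proof -
  obtain r where r: "d = c @ r" using assms(3) by (auto elim: prefixE)
  have "count_list r 1 = 0" using assms(1,2) r by (simp add: stopped_words_def)
  moreover have "last r = 1" if "r \<noteq> []" using assms(2) r that by (simp add: stopped_words_def)
  ultimately have "r = []" by (metis count_list_0_iff last_in_set)
  with r show ?thesis by simp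
qed

lemma stopped_words_target_unique:
  assumes "d \<in> stopped_words L z a" "d \<in> stopped_words L z b" "l \<in> {1..L}"
  shows "a l = b l"
  using assms by (fastforce simp: stopped_words_def)

lemma stopped_words_cong:
  assumes "\<And>l. l \<in> {1..L} \<Longrightarrow> z l = y l" "\<And>l. l \<in> {1..L} \<Longrightarrow> z' l = y' l"
  shows "stopped_words L z z' = stopped_words L y y'"
proof -
  have "vec_norm L z = vec_norm L y" unfolding vec_norm_def by (rule sum.cong) (auto simp: assms)
  then show ?thesis using assms unfolding stopped_words_def by auto
qed

section \<open>Crossings of a path that climbs by single steps\<close>

primrec jumps_from :: "(nat \<Rightarrow> int) \<Rightarrow> int \<Rightarrow> nat \<Rightarrow> int list" where
  "jumps_from X x 0 = []"
| "jumps_from X x (Suc t) = jumps_from X x t @ (if X t = x then [X (Suc t) - X t] else [])"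

lemma jumps_from_mono: "s \<le> t \<Longrightarrow> prefix (jumps_from X x s) (jumps_from X x t)"
  by (induction t) (auto simp: le_Suc_eq)

lemma count_jumps_from:
  "count_list (jumps_from X x t) i = (\<Sum>k<t. of_bool (X k = x \<and> X (Suc k) = x + i))"
proof (induction t)
  case (Suc t)
  have "count_list (if X t = x then [X (Suc t) - X t] else []) i =
      of_bool (X t = x \<and> X (Suc t) = x + i)"
  proof (cases "X t = x")
    case True
    then have "X (Suc t) - X t = i \<longleftrightarrow> X (Suc t) = x + i" by linarith
    with True show ?thesis by simp
  qed simp
  with Suc show ?case by (simp only: jumps_from.simps count_list_append length_append sum.lessThan_Suc)
qed simp

lemma length_jumps_from: "length (jumps_from X x t) = (\<Sum>k<t. of_bool (X k = x))"
proof (induction t)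
  case (Suc t)
  have "length (if X t = x then [X (Suc t) - X t] else []) = of_bool (X t = x)" by simp
  with Suc show ?case by (simp only: jumps_from.simps count_list_append length_append sum.lessThan_Suc)
qed simp

lemma set_jumps_from: "(\<And>j. X (Suc j) - X j \<in> S) \<Longrightarrow> set (jumps_from X x t) \<subseteq> S"
proof (induction t)
  case (Suc t)
  have "set (if X t = x then [X (Suc t) - X t] else []) \<subseteq> S" using Suc.prems[of t] by (cases "X t = x") (simp_all only: if_True if_False list.set empty_subsetI insert_subset simp_thms)
  with Suc show ?case by (simp only: jumps_from.simps set_append Un_least)
qed simp

lemma jumps_from_cong:
  "(\<And>j. j \<le> t \<Longrightarrow> X j = Y j) \<Longrightarrow> jumps_from X x t = jumps_from Y x t"
  by (induction t) auto

text \<open>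
Downward crossings of \<open>i\<close> before a deterministic time, so that the combinatorics can be done by
induction on that time; taken at a hitting time this is \<open>down_jumps\<close>.
\<close>

definition crossings :: "nat \<Rightarrow> (nat \<Rightarrow> int) \<Rightarrow> int \<Rightarrow> nat \<Rightarrow> nat \<Rightarrow> nat" where
  "crossings L X i T = (\<lambda>l\<in>{1..L}. \<Sum>k<T. of_bool (X k > i \<and> X (Suc k) = i - int l + 1))"

lemma steps_cases:
  assumes "i \<in> steps L"
  obtains "i = 1" | l where "l \<in> {1..L}" "i = - int l"
proof (cases "i = 1")
  case False
  with assms have "nat (- i) \<in> {1..L}" "i = - int (nat (- i))" by (auto simp: steps_def)
  then show ?thesis using that by blast
qed

locale skip_free_path =
  fixes L :: nat and X :: "nat \<Rightarrow> int"
  assumes start: "X 0 = 0" and step: "X (Suc j) - X j \<in> steps L"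
begin

lemma upward_step: "X (Suc j) \<le> X j + 1"
  using step[of j] by (auto simp: steps_def)

lemma up_step_iff: "X (Suc j) > X j \<longleftrightarrow> X (Suc j) = X j + 1"
  using step[of j] by (auto simp: steps_def)

lemma downward_step: "X (Suc j) \<ge> X j - int L"
  using step[of j] by (auto simp: steps_def)

lemma below_before_hitting:
  assumes "\<And>j. j < T \<Longrightarrow> X j \<noteq> int n" "n > 0" "j < T"
  shows "X j < int n"
  using assms(3)
proof (induction j)
  case 0
  then show ?case using start assms(2) by simp
next
  case (Suc j)
  then show ?case using upward_step[of j] assms(1)[of "Suc j"] by simp
qed

text \<open>
A step has size at most \<open>L\<close>, so a crossing of \<open>i\<close> from above lands on exactly one of the points
\<open>i, i - 1, \<dots>, i - L + 1\<close>.
\<close>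

lemma vec_norm_crossings:
  "vec_norm L (crossings L X i T) = (\<Sum>k<T. of_bool (X k > i \<and> X (Suc k) \<le> i))"
proof -
  have "(\<Sum>l\<in>{1..L}. of_bool (X k > i \<and> X (Suc k) = i - int l + 1)) =
        (of_bool (X k > i \<and> X (Suc k) \<le> i) :: nat)" for k
  proof (cases "X k > i \<and> X (Suc k) \<le> i")
    case True
    define l0 where "l0 = nat (i - X (Suc k) + 1)"
    have "l0 \<in> {1..L}" using True downward_step[of k] by (auto simp: l0_def)
    moreover have "of_bool (X k > i \<and> X (Suc k) = i - int l + 1) = (if l = l0 then 1 else 0 :: nat)" for l
      using True by (auto simp: l0_def)
    ultimately show ?thesis using True by simp
  qed auto
  then have "(\<Sum>k<T. \<Sum>l\<in>{1..L}. of_bool (X k > i \<and> X (Suc k) = i - int l + 1)) =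
      (\<Sum>k<T. of_bool (X k > i \<and> X (Suc k) \<le> i) :: nat)"
    by (simp only:)
  then show ?thesis
    by (subst (asm) sum.swap) (simp add: vec_norm_def crossings_def del: sum_of_bool_eq One_nat_def)
qed

text \<open>
Upward and downward crossings of \<open>i\<close> alternate. The path starts at or below \<open>i\<close>, and it can cross
upwards only by a unit step from \<open>i\<close> itself.
\<close>

lemma upcrossing_balance:
  assumes "i \<ge> 0"
  shows "of_bool (X T > i) + vec_norm L (crossings L X i T) = count_list (jumps_from X i T) 1"
proof (induction T)
  case 0
  then show ?case using assms start by (simp add: vec_norm_def crossings_def)
next
  case (Suc T)
  then show ?case
    using upward_step[of T] up_step_iff[of T] unfolding vec_norm_crossings by auto
qed

text \<open>
The path can get above \<open>i\<close> only through \<open>i\<close>, so if it is above \<open>i\<close>, its last departure from \<open>i\<close>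
was upwards.
\<close>

lemma last_jump_up:
  assumes "i \<ge> 0" "X T > i"
  shows "last (jumps_from X i T) = 1"
  using assms(2)
proof (induction T)
  case 0
  then show ?case using assms start by simp
next
  case (Suc T)
  then show ?case
    using upward_step[of T] up_step_iff[of T] by (cases "X T = i") auto
qed

text \<open>
A downward crossing of \<open>i\<close> starts either at \<open>i + 1\<close> or higher up. In the second case it is also a
crossing of \<open>i + 1\<close>, with an overshoot larger by one; for \<open>l = L\<close> this would be a step longer than \<open>L\<close>.
\<close>

lemma crossings_recursion:
  assumes "l \<in> {1..L}"
  shows "crossings L X i T l =
    count_list (jumps_from X (i + 1) T) (- int l) + (if l < L then crossings L X (i + 1) T (l + 1) else 0)"
proof -
  have "of_bool (X k > i \<and> X (Suc k) = i - int l + 1) =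
     (of_bool (X k = i + 1 \<and> X (Suc k) = i + 1 + - int l) :: nat) +
     (if l < L then of_bool (X k > i + 1 \<and> X (Suc k) = (i + 1) - int (l + 1) + 1) else 0)" for k
    using downward_step[of k] assms by auto
  then show ?thesis using assms
    by (simp add: algebra_simps crossings_def count_jumps_from sum.distrib del: sum_of_bool_eq)
qed

lemma jumps_from_stopped_words:
  assumes "i \<ge> 0" "X T > i"
  shows "jumps_from X i T \<in> stopped_words L (crossings L X i T) (crossings L X (i - 1) T)"
  using set_jumps_from[of X "steps L" i T, OF step] last_jump_up[OF assms]
    upcrossing_balance[OF assms(1), of T] crossings_recursion[of _ "i - 1" T] assms
  by (simp add: stopped_words_def)

end

lemma crossings_top:
  assumes "\<And>j. j < T \<Longrightarrow> X j < int n"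
  shows "crossings L X (int n - 1) T = (\<lambda>l\<in>{1..L}. 0)"
  using assms by (fastforce simp: crossings_def)

section \<open>A martingale for prescribed step words\<close>

locale excited_walk = prob_space P for P :: "'a measure" +
  fixes L :: nat and p :: "nat \<Rightarrow> int pmf" and X :: "nat \<Rightarrow> 'a \<Rightarrow> int"
  assumes X_measurable [measurable]: "\<And>n. X n \<in> measurable P (count_space UNIV)"
    and start_at_0: "AE w in P. X 0 w = 0"
    and transition: "\<And>n i. i \<in> steps L \<Longrightarrow> AE w in P.
        real_cond_exp P (nat_filtration P X n) (\<lambda>w'. of_bool (X (Suc n) w' = X n w' + i)) w
          = pmf (p (visits X (X n w) n w)) i"
    and support: "\<And>j. set_pmf (p (Suc j)) \<subseteq> steps L"
begin

abbreviation path :: "'a \<Rightarrow> nat \<Rightarrow> int" where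
  "path w \<equiv> \<lambda>j. X j w"

lemma subalgebra_filtration: "subalgebra P (nat_filtration P X n)"
  unfolding subalgebra_def nat_filtration_def
proof
  show "sets (sigma (space P) {X k -` B \<inter> space P |k B. k \<le> n}) \<subseteq> sets P"
    by (rule sigma_le_sets[THEN iffD2]) (auto intro: measurable_sets[OF X_measurable])
qed (simp add: space_measure_of_conv)

lemma space_filtration [simp]: "space (nat_filtration P X n) = space P"
  by (simp add: nat_filtration_def space_measure_of_conv)

lemma X_adapted:
  assumes "j \<le> n"
  shows "X j \<in> measurable (nat_filtration P X n) (count_space UNIV)"
proof (rule measurableI)
  fix B :: "int set"
  have "X j -` B \<inter> space P \<in> sigma_sets (space P) {X k -` B \<inter> space P | k B. k \<le> n}"
    using assms by (intro sigma_sets.Basic) blast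
  then show "X j -` B \<inter> space (nat_filtration P X n) \<in> sets (nat_filtration P X n)"
    unfolding nat_filtration_def by (simp add: sets_measure_of_conv space_measure_of_conv) blast
qed simp

lemma history_adapted:
  assumes "m \<le> Suc n"
  shows "(\<lambda>w. map (path w) [0..<m]) \<in> measurable (nat_filtration P X n) (count_space UNIV)"
  using assms
proof (induction m)
  case (Suc m)
  have "X m \<in> measurable (nat_filtration P X n) (count_space UNIV)"
    using Suc.prems by (intro X_adapted) simp
  then have "(\<lambda>w. (map (path w) [0..<m], X m w)) \<in>
      measurable (nat_filtration P X n) (count_space UNIV \<Otimes>\<^sub>M count_space UNIV)"
    using Suc by (intro measurable_Pair) auto
  then have "(\<lambda>w. (map (path w) [0..<m], X m w)) \<in>
      measurable (nat_filtration P X n) (count_space UNIV)"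
    by (simp add: pair_measure_countable)
  from measurable_compose[OF this, of "\<lambda>(xs, x). xs @ [x]" "count_space UNIV"]
  show ?case by simp
qed simp

text \<open>
A function of finitely many integer coordinates factors through the discrete space of integer
lists, on which every function is measurable.
\<close>

lemma adapted:
  fixes f :: "(nat \<Rightarrow> int) \<Rightarrow> real"
  assumes "\<And>x y. (\<And>j. j \<le> n \<Longrightarrow> x j = y j) \<Longrightarrow> f x = f y"
  shows "(\<lambda>w. f (path w)) \<in> borel_measurable (nat_filtration P X n)"
proof -
  have "(\<lambda>w. f (\<lambda>j. map (path w) [0..<Suc n] ! j)) \<in> borel_measurable (nat_filtration P X n)"
    by (rule measurable_compose[OF history_adapted[of "Suc n" n]]) auto
  moreover have "f (\<lambda>j. map (path w) [0..<Suc n] ! j) = f (path w)" for w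
  proof (rule assms)
    fix j assume "j \<le> n"
    then have "[0..<Suc n] ! j = j" by (simp del: upt_Suc)
    with \<open>j \<le> n\<close> show "map (path w) [0..<Suc n] ! j = path w j" by (simp del: upt_Suc)
  qed
  ultimately show ?thesis by (simp del: upt_Suc)
qed

lemma visits_eq: "visits X (X n w) n w = Suc (length (jumps_from (path w) (X n w) n))"
proof -
  have "{0..n} = insert n {..<n}" by auto
  then show ?thesis by (simp add: visits_def length_jumps_from del: sum_of_bool_eq)
qed

lemma sum_transition: "(\<Sum>i\<in>steps L. pmf (p (visits X (X n w) n w)) i) = 1"
  unfolding visits_eq by (intro sum_pmf_eq_1 support) simp

lemma transition_integral:
  fixes f :: "(nat \<Rightarrow> int) \<Rightarrow> real"
  assumes f: "\<And>x y. (\<And>j. j \<le> n \<Longrightarrow> x j = y j) \<Longrightarrow> f x = f y"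
    and bd: "\<And>x. \<bar>f x\<bar> \<le> 1" and i: "i \<in> steps L"
  shows "(\<integral>w. f (path w) * of_bool (X (Suc n) w = X n w + i) \<partial>P) =
         (\<integral>w. f (path w) * pmf (p (visits X (X n w) n w)) i \<partial>P)"
    and "integrable P (\<lambda>w. f (path w) * of_bool (X (Suc n) w = X n w + i))"
    and "integrable P (\<lambda>w. f (path w) * pmf (p (visits X (X n w) n w)) i)"
proof -
  let ?F = "nat_filtration P X n"
  let ?g = "\<lambda>w. of_bool (X (Suc n) w = X n w + i) :: real"
  interpret finite_measure_subalgebra P ?F
    by unfold_locales (rule subalgebra_filtration)
  have fF: "(\<lambda>w. f (path w)) \<in> borel_measurable ?F" by (rule adapted) (rule f)
  then have fP [measurable]: "(\<lambda>w. f (path w)) \<in> borel_measurable P"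
    by (rule measurable_from_subalg[OF subalgebra_filtration])
  have gP [measurable]: "?g \<in> borel_measurable P" by measurable
  have pF: "(\<lambda>w. pmf (p (visits X (X n w) n w)) i) \<in> borel_measurable ?F"
    unfolding visits_eq
  proof (rule adapted[where f = "\<lambda>x. pmf (p (Suc (length (jumps_from x (x n) n)))) i"])
    fix x y :: "nat \<Rightarrow> int" assume eq: "\<And>j. j \<le> n \<Longrightarrow> x j = y j"
    show "pmf (p (Suc (length (jumps_from x (x n) n)))) i = pmf (p (Suc (length (jumps_from y (y n) n)))) i"
      using jumps_from_cong[of n x y, OF eq] eq[of n] by simp
  qed
  then have [measurable]: "(\<lambda>w. pmf (p (visits X (X n w) n w)) i) \<in> borel_measurable P"
    by (rule measurable_from_subalg[OF subalgebra_filtration])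
  show int: "integrable P (\<lambda>w. f (path w) * ?g w)"
    by (rule integrable_const_bound[where B = 1]) (auto simp: bd abs_mult)
  show "integrable P (\<lambda>w. f (path w) * pmf (p (visits X (X n w) n w)) i)"
    by (rule integrable_const_bound[where B = 1])
       (auto simp: abs_mult bd pmf_le_1 intro!: mult_le_one)
  have "(\<integral>w. f (path w) * ?g w \<partial>P) = (\<integral>w. f (path w) * real_cond_exp P ?F ?g w \<partial>P)"
    by (rule real_cond_exp_intg(2)[OF int fF gP, symmetric])
  also have "\<dots> = (\<integral>w. f (path w) * pmf (p (visits X (X n w) n w)) i \<partial>P)"
  proof (rule integral_cong_AE)
    show "AE w in P. f (path w) * real_cond_exp P ?F ?g w = f (path w) * pmf (p (visits X (X n w) n w)) i"
      using transition[OF i, of n] by eventually_elim simp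
    show "(\<lambda>w. f (path w) * real_cond_exp P ?F ?g w) \<in> borel_measurable P"
      using borel_measurable_cond_exp2[of P ?F] by measurable
  qed measurable
  finally show "(\<integral>w. f (path w) * ?g w \<partial>P) = (\<integral>w. f (path w) * pmf (p (visits X (X n w) n w)) i \<partial>P)" .
qed

text \<open>
The transition probabilities over \<open>steps L\<close> add up to one, which leaves no mass for other steps.
\<close>

lemma AE_step: "AE w in P. X (Suc n) w - X n w \<in> steps L"
proof -
  have *: "(\<integral>w. of_bool (X (Suc n) w = X n w + i) \<partial>P) =
      (\<integral>w. pmf (p (visits X (X n w) n w)) i \<partial>P)"
    "integrable P (\<lambda>w. of_bool (X (Suc n) w = X n w + i) :: real)"
    "integrable P (\<lambda>w. pmf (p (visits X (X n w) n w)) i)" if "i \<in> steps L" for i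
    using transition_integral[of n "\<lambda>_. 1" i] that by auto
  have eq: "(\<Sum>i\<in>steps L. of_bool (X (Suc n) w = X n w + i)) =
      (indicator {w \<in> space P. X (Suc n) w - X n w \<in> steps L} w :: real)" if "w \<in> space P" for w
  proof -
    have "X (Suc n) w = X n w + i \<longleftrightarrow> i = X (Suc n) w - X n w" for i by auto
    then have "(\<Sum>i\<in>steps L. of_bool (X (Suc n) w = X n w + i)) =
      (\<Sum>i\<in>steps L. if i = X (Suc n) w - X n w then 1 else 0 :: real)"
      by (intro sum.cong) auto
    then show ?thesis using that by (simp add: indicator_def)
  qed
  have "prob {w \<in> space P. X (Suc n) w - X n w \<in> steps L} =
    (\<integral>w. indicator {w \<in> space P. X (Suc n) w - X n w \<in> steps L} w \<partial>P)"
    by simp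
  also have "\<dots> = (\<integral>w. (\<Sum>i\<in>steps L. of_bool (X (Suc n) w = X n w + i)) \<partial>P)"
    by (intro Bochner_Integration.integral_cong refl eq[symmetric])
  also have "\<dots> = (\<Sum>i\<in>steps L. \<integral>w. of_bool (X (Suc n) w = X n w + i) \<partial>P)"
    by (rule Bochner_Integration.integral_sum) (rule *)
  also have "\<dots> = (\<Sum>i\<in>steps L. \<integral>w. pmf (p (visits X (X n w) n w)) i \<partial>P)"
    by (intro sum.cong refl *)
  also have "\<dots> = (\<integral>w. (\<Sum>i\<in>steps L. pmf (p (visits X (X n w) n w)) i) \<partial>P)"
    by (rule Bochner_Integration.integral_sum[symmetric]) (rule *)
  also have "\<dots> = 1" unfolding sum_transition by (simp add: prob_space)
  finally show ?thesis
    by (subst (asm) prob_Collect_eq_1) auto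
qed

lemma AE_skip_free_path: "AE w in P. skip_free_path L (path w)"
proof -
  have "AE w in P. \<forall>n. X (Suc n) w - X n w \<in> steps L"
    unfolding AE_all_countable using AE_step by blast
  with start_at_0 show ?thesis by eventually_elim (simp add: skip_free_path_def)
qed

text \<open>
The conditional probability, given the path up to time \<open>t\<close>, that the steps from the sites \<open>s k\<close>
would spell the words \<open>d k\<close> if all these sites were visited sufficiently often.
\<close>

definition likelihood :: "('k \<Rightarrow> int) \<Rightarrow> 'k set \<Rightarrow> ('k \<Rightarrow> int list) \<Rightarrow> nat \<Rightarrow> 'a \<Rightarrow> real" where
  "likelihood s K d t w = (\<Prod>k\<in>K. completion_weight p (d k) (jumps_from (path w) (s k) t))"

lemma likelihood_bounds: "0 \<le> likelihood s K d t w" "likelihood s K d t w \<le> 1"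
  unfolding likelihood_def
  by (auto intro!: prod_nonneg prod_le_1 simp: completion_weight_nonneg completion_weight_le_1)

lemma likelihood_measurable [measurable]: "likelihood s K d t \<in> borel_measurable P"
proof -
  have "likelihood s K d t \<in> borel_measurable (nat_filtration P X t)"
    unfolding likelihood_def
    by (rule adapted[where f = "\<lambda>x. \<Prod>k\<in>K. completion_weight p (d k) (jumps_from x (s k) t)"])
       (simp cong: jumps_from_cong)
  then show ?thesis by (rule measurable_from_subalg[OF subalgebra_filtration])
qed

text \<open>
Only the site occupied at time \<open>t\<close> receives a new letter, and since \<open>s\<close> is injective this affects at
most one factor. Conditionally on the past the letter has the law of the current visit number, so
the expectation of that factor is given by \<open>completion_weight_average\<close>.
\<close>

lemma expectation_likelihood_Suc:
  assumes K: "finite K" "inj_on s K"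
  shows "(\<integral>w. likelihood s K d (Suc t) w \<partial>P) = (\<integral>w. likelihood s K d t w \<partial>P)"
proof -
  define g where "g i x = (\<Prod>k\<in>K. completion_weight p (d k)
      (jumps_from x (s k) t @ (if x t = s k then [i] else [])))" for i :: int and x :: "nat \<Rightarrow> int"
  \<comment> \<open>\<open>g i\<close> is the likelihood at time \<open>Suc t\<close> if the step at time \<open>t\<close> is \<open>i\<close>; it depends on the path only up to \<open>t\<close>.\<close>
  let ?v = "\<lambda>w. visits X (X t w) t w"
  have g_cong: "g i x = g i y" if "\<And>j. j \<le> t \<Longrightarrow> x j = y j" for i x y
    unfolding g_def using that jumps_from_cong[of t x y] by simp
  have g_bound: "\<bar>g i x\<bar> \<le> 1" for i x
    unfolding g_def abs_prod
    by (intro prod_le_1) (auto simp: completion_weight_nonneg completion_weight_le_1)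
  note * = transition_integral[of t "g i" i for i, OF g_cong g_bound, simplified]
  have avg: "(\<Sum>i\<in>steps L. g i (path w) * pmf (p (?v w)) i) = likelihood s K d t w" for w
  proof (cases "\<exists>k\<in>K. X t w = s k")
    case False
    then have "g i (path w) = likelihood s K d t w" for i
      unfolding g_def likelihood_def by (intro prod.cong) auto
    then show ?thesis by (simp add: sum_distrib_left[symmetric] sum_transition)
  next
    case True
    then obtain k where k: "k \<in> K" "X t w = s k" by blast
    define r where "r = (\<Prod>k'\<in>K - {k}. completion_weight p (d k') (jumps_from (path w) (s k') t))"
    let ?u = "jumps_from (path w) (s k) t"
    have other: "X t w \<noteq> s k'" if "k' \<in> K - {k}" for k'
      using that k K(2) by (auto dest: inj_onD)
    have "g i (path w) = completion_weight p (d k) (?u @ [i]) * r" for i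
      unfolding g_def r_def prod.remove[OF K(1) k(1)] using k(2) other
      by (intro arg_cong2[where f = "(*)"] prod.cong) auto
    moreover have "likelihood s K d t w = completion_weight p (d k) ?u * r"
      unfolding likelihood_def r_def by (rule prod.remove[OF K(1) k(1)])
    moreover have "(\<Sum>i\<in>steps L. pmf (p (?v w)) i * completion_weight p (d k) (?u @ [i])) =
        completion_weight p (d k) ?u"
      using completion_weight_average[of "steps L" p ?u, OF finite_steps support] visits_eq[of t w]
      by (simp add: k(2))
    ultimately show ?thesis by (simp add: sum_distrib_left[symmetric] mult_ac)
  qed
  have "(\<integral>w. likelihood s K d (Suc t) w \<partial>P) =
      (\<integral>w. (\<Sum>i\<in>steps L. g i (path w) * of_bool (X (Suc t) w = X t w + i)) \<partial>P)"
  proof (rule integral_cong_AE)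
    show "AE w in P. likelihood s K d (Suc t) w =
        (\<Sum>i\<in>steps L. g i (path w) * of_bool (X (Suc t) w = X t w + i))"
      using AE_step[of t]
    proof eventually_elim
      case (elim w)
      let ?j = "X (Suc t) w - X t w"
      have "likelihood s K d (Suc t) w = g ?j (path w)"
        by (simp add: likelihood_def g_def cong: if_cong)
      also have "\<dots> = (\<Sum>i\<in>steps L. if i = ?j then g i (path w) else 0)"
        using elim by simp
      also have "\<dots> = (\<Sum>i\<in>steps L. g i (path w) * of_bool (X (Suc t) w = X t w + i))"
        by (intro sum.cong) auto
      finally show ?case .
    qed
    show "(\<lambda>w. \<Sum>i\<in>steps L. g i (path w) * of_bool (X (Suc t) w = X t w + i)) \<in> borel_measurable P"
      using * by (intro borel_measurable_sum) (auto intro: borel_measurable_integrable)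
  qed measurable
  also have "\<dots> = (\<Sum>i\<in>steps L. \<integral>w. g i (path w) * of_bool (X (Suc t) w = X t w + i) \<partial>P)"
    by (rule Bochner_Integration.integral_sum) (rule *)
  also have "\<dots> = (\<Sum>i\<in>steps L. \<integral>w. g i (path w) * pmf (p (?v w)) i \<partial>P)"
    by (intro sum.cong refl *)
  also have "\<dots> = (\<integral>w. (\<Sum>i\<in>steps L. g i (path w) * pmf (p (?v w)) i) \<partial>P)"
    by (rule Bochner_Integration.integral_sum[symmetric]) (rule *)
  finally show ?thesis unfolding avg .
qed

lemma expectation_likelihood:
  assumes "finite K" "inj_on s K"
  shows "(\<integral>w. likelihood s K d t w \<partial>P) = (\<Prod>k\<in>K. completion_weight p (d k) [])"
proof (induction t)
  case 0
  then show ?case by (simp add: likelihood_def prob_space)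
next
  case (Suc t)
  then show ?case by (simp add: expectation_likelihood_Suc[OF assms])
qed

end

section \<open>The law of the downward jumps\<close>

lemma vec_space_eq: "vec_space d = count_space (\<Pi>\<^sub>E l\<in>{1..d}. UNIV)"
  using count_space_PiM_finite[of "{1..d}" "\<lambda>_. UNIV :: nat set"] by (simp add: vec_space_def comp_def)

text \<open>
This will turn out to be the probability that the branching process moves from \<open>z\<close> to \<open>z'\<close>.
\<close>

definition transition_weight ::
  "nat \<Rightarrow> (nat \<Rightarrow> int pmf) \<Rightarrow> (nat \<Rightarrow> nat) \<Rightarrow> (nat \<Rightarrow> nat) \<Rightarrow> real" where
  "transition_weight L p z z' = (\<Sum>d\<in>stopped_words L z z'. completion_weight p d [])"

text \<open>
Once the observed word \<open>v\<close> extends a stopped word \<open>u\<close> with the same number of upward steps as \<open>d\<close>, the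
prefix-code property decides everything: a \<open>d\<close> different from \<open>u\<close> is incomparable with \<open>v\<close>.
\<close>

lemma completion_weight_complete:
  assumes "u \<in> stopped_words L z a" "d \<in> stopped_words L z b" "prefix u v"
  shows "completion_weight p d v = of_bool (d = u)"
proof (cases "d = u")
  case True
  then show ?thesis using assms(3) by (auto simp: completion_weight_def dest: prefix_length_le)
next
  case False
  have "\<not> prefix v d"
  proof
    assume "prefix v d"
    with assms(3) have "prefix u d" by (rule prefix_order.trans)
    from stopped_words_prefix_eq[OF assms(1,2) this] False show False by simp
  qed
  moreover have "\<not> prefix d v"
  proof
    assume "prefix d v"
    then have "prefix d u \<or> prefix u d" using assms(3) prefix_same_cases by blast
    then show False
      using stopped_words_prefix_eq[OF assms(1,2)] stopped_words_prefix_eq[OF assms(2,1)] False by auto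
  qed
  ultimately show ?thesis using False by (simp add: completion_weight_def)
qed

text \<open>
Here \<open>u k\<close> are the words observed up to the hitting time, \<open>v k\<close> the crossing vectors they produce, and
\<open>y k\<close> the words observed later. If \<open>v\<close> and \<open>z\<close> differ, consider the first such index \<open>k\<close>: the vectors
before it agree, so \<open>u k\<close> and the words prescribed at \<open>k\<close> belong to the same prefix code, but \<open>u k\<close>
leads to the wrong target; hence every prescribed word is contradicted there.
\<close>

lemma sum_completion_weights_eq_indicator:
  fixes z v :: "nat \<Rightarrow> nat \<Rightarrow> nat"
  assumes v0: "v 0 = z 0"
    and z: "\<And>k. k < n \<Longrightarrow> z k \<in> extensional {1..L}"
    and v: "\<And>k. k < n \<Longrightarrow> v k \<in> extensional {1..L}"
    and u: "\<And>k. k \<in> {1..<n} \<Longrightarrow> u k \<in> stopped_words L (v (k - 1)) (v k)"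
    and y: "\<And>k. k \<in> {1..<n} \<Longrightarrow> prefix (u k) (y k)"
  shows "(\<Sum>d\<in>(\<Pi>\<^sub>E k\<in>{1..<n}. stopped_words L (z (k - 1)) (z k)).
           \<Prod>k\<in>{1..<n}. completion_weight p (d k) (y k)) = of_bool (\<forall>k<n. v k = z k)"
proof -
  let ?D = "\<lambda>k. stopped_words L (z (k - 1)) (z k)"
  have "(\<Prod>k\<in>{1..<n}. \<Sum>d\<in>?D k. completion_weight p d (y k)) = of_bool (\<forall>k<n. v k = z k)"
  proof (cases "\<forall>k<n. v k = z k")
    case True
    have "(\<Sum>d\<in>?D k. completion_weight p d (y k)) = 1" if k: "k \<in> {1..<n}" for k
    proof -
      have uk: "u k \<in> ?D k" using u[OF k] True k by auto
      then have "(\<Sum>d\<in>?D k. completion_weight p d (y k)) = (\<Sum>d\<in>?D k. of_bool (d = u k))"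
        using y[OF k] by (intro sum.cong completion_weight_complete) auto
      also have "\<dots> = (\<Sum>d\<in>?D k. if d = u k then 1 else 0)" by (intro sum.cong) auto
      finally show ?thesis using uk finite_stopped_words by simp
    qed
    with True show ?thesis by simp
  next
    case False
    define k where "k = (LEAST k. k < n \<and> v k \<noteq> z k)"
    have k: "k < n" "v k \<noteq> z k" unfolding k_def using False by (metis (mono_tags, lifting) LeastI)+
    have before: "v j = z j" if "j < k" for j
      using not_less_Least[OF that[unfolded k_def]] that k(1) by auto
    have k1: "k \<in> {1..<n}" using k v0 by (cases k) auto
    have uk: "u k \<in> stopped_words L (z (k - 1)) (v k)" using u[OF k1] before[of "k - 1"] k1 by simp
    have "completion_weight p d (y k) = 0" if d: "d \<in> ?D k" for d
    proof -
      have "d \<noteq> u k"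
      proof
        assume "d = u k"
        with d uk have "v k l = z k l" if "l \<in> {1..L}" for l
          using stopped_words_target_unique that by metis
        then have "v k = z k" using z[OF k(1)] v[OF k(1)] by (auto intro: extensionalityI)
        with k(2) show False ..
      qed
      then show ?thesis using completion_weight_complete[OF uk d y[OF k1]] by simp
    qed
    then have "(\<Sum>d\<in>?D k. completion_weight p d (y k)) = 0" by simp
    with k1 have "(\<Prod>k\<in>{1..<n}. \<Sum>d\<in>?D k. completion_weight p d (y k)) = 0"
      by (intro prod_zero) auto
    moreover have "(\<forall>k<n. v k = z k) = False" using False by simp
    ultimately show ?thesis by (simp only: of_bool_eq)
  qed
  then show ?thesis
    by (subst prod_sum_PiE[symmetric]) (auto simp: finite_stopped_words)
qed

lemma Inf_enat_Collect:
  "Inf {enat k | k. R k} = (if \<exists>k. R k then enat (LEAST k. R k) else \<infinity>)"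
proof (cases "\<exists>k. R k")
  case True
  then have "R (LEAST k. R k)" by (rule LeastI_ex)
  then have "Inf {enat k | k. R k} = enat (LEAST k. R k)"
    by (intro antisym Inf_lower Inf_greatest) (auto intro: Least_le)
  with True show ?thesis by simp
qed (simp add: top_enat_def)

lemma hit_time_eq:
  "hit_time X n w = (if \<exists>k. X k w = int n then enat (LEAST k. X k w = int n) else \<infinity>)"
  by (simp only: hit_time_def Inf_enat_Collect)

lemma down_jumps_eq_crossings:
  assumes "\<exists>k. X k w = int n"
  shows "down_jumps L X n i w = crossings L (\<lambda>j. X j w) i (LEAST k. X k w = int n)"
proof -
  have "{k. enat k < hit_time X n w} = {..<LEAST k. X k w = int n}"
    using assms by (auto simp: hit_time_eq)
  then show ?thesis by (simp only: down_jumps_def crossings_def)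
qed

lemma down_jumps_extensional: "down_jumps L X n i w \<in> extensional {1..L}"
  by (simp only: down_jumps_def restrict_extensional)

context excited_walk
begin

text \<open>
The time horizon of the sum is the random hitting time; on paths that never reach \<open>n\<close> the index set
is infinite and the sum is \<open>0\<close>.
\<close>

lemma down_jumps_measurable:
  "down_jumps L X n i \<in> measurable P (vec_space L)"
  unfolding vec_space_def
proof (rule measurable_PiM_single')
  fix l assume l: "l \<in> {1..L}"
  let ?T = "\<lambda>w. LEAST k. X k w = int n"
  have "down_jumps L X n i w l = (if \<exists>k. X k w = int n
      then \<Sum>k<?T w. of_bool (X k w > i \<and> X (Suc k) w = i - int l + 1) else 0)" for w
  proof (cases "\<exists>k. X k w = int n")
    case True
    then show ?thesis using l unfolding down_jumps_eq_crossings[of X w n, OF True] crossings_def by simp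
  next
    case False
    then have "{k. enat k < hit_time X n w} = UNIV" by (auto simp: hit_time_eq)
    with False l show ?thesis by (simp add: down_jumps_def)
  qed
  moreover have "(\<lambda>w. \<Sum>k<t. of_bool (X k w > i \<and> X (Suc k) w = i - int l + 1) :: nat)
      \<in> measurable P (count_space UNIV)" for t :: nat
    by measurable
  then have "(\<lambda>w. \<Sum>k<?T w. of_bool (X k w > i \<and> X (Suc k) w = i - int l + 1) :: nat)
      \<in> measurable P (count_space UNIV)"
    by (rule measurable_compose_countable) measurable
  ultimately show "(\<lambda>w. down_jumps L X n i w l) \<in> measurable P (count_space UNIV)"
    by simp
qed (auto simp: down_jumps_def)

text \<open>
The sum \<open>M t\<close> of the likelihoods of all admissible word tuples has a constant expectation, lies
between \<open>0\<close> and the number of tuples, and, if \<open>z 0\<close> is zero, is eventually equal to the indicator of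
the event. For other \<open>z 0\<close> the event is null, as \<open>n - 1\<close> is not crossed downwards before \<open>n\<close> is hit. The
sites are traversed downwards, \<open>k\<close> standing for the site \<open>n - k\<close>.
\<close>

lemma prob_down_jumps:
  fixes z :: "nat \<Rightarrow> nat \<Rightarrow> nat"
  assumes transient: "AE w in P. filterlim (\<lambda>k. X k w) at_top sequentially"
    and n: "n \<ge> 1" and z: "\<And>k. k < n \<Longrightarrow> z k \<in> extensional {1..L}"
  shows "prob {w \<in> space P. \<forall>k<n. down_jumps L X n (int n - 1 - int k) w = z k} =
    of_bool (z 0 = (\<lambda>l\<in>{1..L}. 0)) *
    (\<Prod>k\<in>{1..<n}. transition_weight L p (z (k - 1)) (z k))"
proof -
  let ?V = "\<lambda>w k. down_jumps L X n (int n - 1 - int k) w"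
  let ?E = "{w \<in> space P. \<forall>k<n. ?V w k = z k}"
  let ?s = "\<lambda>k. int n - int k" and ?K = "{1..<n}"
  let ?D = "\<Pi>\<^sub>E k\<in>?K. stopped_words L (z (k - 1)) (z k)"
  have finD: "finite ?D" by (intro finite_PiE) (auto simp: finite_stopped_words)
  define M where "M t w = (\<Sum>d\<in>?D. likelihood ?s ?K d t w)" for t w
  have path_facts: "AE w in P. ?V w 0 = (\<lambda>l\<in>{1..L}. 0) \<and>
      (z 0 = (\<lambda>l\<in>{1..L}. 0) \<longrightarrow> (\<lambda>t. M t w) \<longlonglongrightarrow> of_bool (\<forall>k<n. ?V w k = z k))"
    using AE_skip_free_path transient
  proof eventually_elim
    case (elim w)
    then interpret skip_free_path L "path w" by simp
    let ?T = "LEAST k. X k w = int n"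
    have "\<exists>k. X k w = int n"
    proof (rule ccontr)
      assume never: "\<nexists>k. X k w = int n"
      have "X j w < int n" for j
        using never n by (intro below_before_hitting[where T = "Suc j"]) auto
      moreover from elim(2) have "eventually (\<lambda>k. X k w \<ge> int n) sequentially"
        by (simp add: filterlim_at_top)
      then obtain j where "X j w \<ge> int n" by (auto simp: eventually_sequentially)
      ultimately show False by (metis linorder_not_le)
    qed
    note V = down_jumps_eq_crossings[of X w n, OF this] and T = LeastI_ex[OF this]
    have below: "X j w < int n" if "j < ?T" for j
      using that n not_less_Least by (intro below_before_hitting[where T = ?T]) auto
    have V0: "?V w 0 = (\<lambda>l\<in>{1..L}. 0)"
      using crossings_top[of ?T "path w" n, OF below] by (simp add: V)
    have "(\<lambda>t. M t w) \<longlonglongrightarrow> of_bool (\<forall>k<n. ?V w k = z k)" if z0: "z 0 = (\<lambda>l\<in>{1..L}. 0)"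
    proof (rule tendsto_eventually, rule eventually_sequentiallyI)
      fix t assume t: "?T \<le> t"
      show "M t w = of_bool (\<forall>k<n. ?V w k = z k)"
        unfolding M_def likelihood_def
      proof (rule sum_completion_weights_eq_indicator[where u = "\<lambda>k. jumps_from (path w) (?s k) ?T"])
        fix k assume k: "k \<in> ?K"
        then show "jumps_from (path w) (?s k) ?T \<in> stopped_words L (?V w (k - 1)) (?V w k)"
          using jumps_from_stopped_words[of "?s k" ?T] T unfolding V
          by (simp add: of_nat_diff algebra_simps)
        show "prefix (jumps_from (path w) (?s k) ?T) (jumps_from (path w) (?s k) t)"
          using t by (rule jumps_from_mono)
      qed (use z z0 V0 in \<open>auto simp: down_jumps_extensional simp del: One_nat_def\<close>)
    qed
    with V0 show ?case by simp
  qed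
  show ?thesis
  proof (cases "z 0 = (\<lambda>l\<in>{1..L}. 0)")
    case False
    have "AE w in P. w \<notin> ?E" using path_facts by eventually_elim (use False n in force)
    then have "prob ?E = 0" by (intro prob_eq_0_AE) auto
    with False show ?thesis by simp
  next
    case True
    have meas: "?E \<in> sets P"
    proof -
      have V: "Measurable.pred P (\<lambda>w. ?V w k = z k)" for k
      proof (rule measurable_compose[OF down_jumps_measurable])
        show "Measurable.pred (vec_space L) (\<lambda>f. f = z k)" by (simp add: vec_space_eq)
      qed
      have "?E = {w \<in> space P. \<forall>k\<in>{..<n}. ?V w k = z k}" by auto
      also have "\<dots> \<in> sets P"
        by (intro sets.sets_Collect_finite_All predE V finite_lessThan)
      finally show ?thesis .
    qed
    have EM: "(\<integral>w. M t w \<partial>P) = (\<Prod>k\<in>?K. transition_weight L p (z (k - 1)) (z k))" for t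
    proof -
      have "integrable P (likelihood ?s ?K d t)" for d
        by (rule integrable_const_bound[where B = 1]) (auto simp: likelihood_bounds)
      then have "(\<integral>w. M t w \<partial>P) = (\<Sum>d\<in>?D. \<integral>w. likelihood ?s ?K d t w \<partial>P)"
        unfolding M_def by (intro Bochner_Integration.integral_sum)
      also have "\<dots> = (\<Sum>d\<in>?D. \<Prod>k\<in>?K. completion_weight p (d k) [])"
        by (intro sum.cong refl expectation_likelihood) (auto simp: inj_on_def)
      also have "\<dots> = (\<Prod>k\<in>?K. transition_weight L p (z (k - 1)) (z k))"
        unfolding transition_weight_def by (subst prod_sum_PiE) (auto simp: finite_stopped_words)
      finally show ?thesis .
    qed
    have "(\<lambda>t. \<integral>w. M t w \<partial>P) \<longlonglongrightarrow> (\<integral>w. indicator ?E w \<partial>P)"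
    proof (rule integral_dominated_convergence[where w = "\<lambda>_. real (card ?D)"])
      show "AE w in P. (\<lambda>t. M t w) \<longlonglongrightarrow> indicator ?E w"
        using path_facts AE_space
      proof eventually_elim
        case (elim w)
        then have "indicator ?E w = (of_bool (\<forall>k<n. ?V w k = z k) :: real)"
          by (auto simp: indicator_def)
        with elim True show ?case by simp
      qed
      show "AE w in P. norm (M t w) \<le> real (card ?D)" for t
      proof (rule AE_I2)
        fix w
        have "norm (M t w) = M t w" unfolding M_def by (simp add: sum_nonneg likelihood_bounds)
        also have "\<dots> \<le> (\<Sum>d\<in>?D. 1)" unfolding M_def by (intro sum_mono likelihood_bounds)
        finally show "norm (M t w) \<le> real (card ?D)" by simp
      qed
      show "indicator ?E \<in> borel_measurable P" using meas by (rule borel_measurable_indicator)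
      show "M t \<in> borel_measurable P" for t
        unfolding M_def[abs_def] by (intro borel_measurable_sum likelihood_measurable)
    qed (rule integrable_const)
    moreover have "(\<integral>w. indicator ?E w \<partial>P) = prob ?E"
    proof -
      have "?E \<inter> space P = ?E" by blast
      then show ?thesis by (simp only: Bochner_Integration.integral_indicator)
    qed
    ultimately have "prob ?E = (\<Prod>k\<in>?K. transition_weight L p (z (k - 1)) (z k))"
      unfolding EM by (simp only: LIMSEQ_const_iff)
    with True show ?thesis by (simp only: of_bool_eq mult_1_left simp_thms)
  qed
qed

end

section \<open>The law of a reward vector\<close>

definition reward_event :: "nat \<Rightarrow> (nat \<Rightarrow> nat) \<Rightarrow> (nat \<Rightarrow> nat) \<Rightarrow> (nat \<Rightarrow> nat \<Rightarrow> nat) set" where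
  "reward_event L z z' = {r \<in> space (proc_space L). \<forall>l\<in>{1..L}.
     r (vec_norm L z) l + (if l < L then z (l + 1) else 0) = z' l}"

lemma sets_reward_event: "reward_event L z z' \<in> sets (proc_space L)"
proof -
  have "(\<lambda>r. r (vec_norm L z)) \<in> measurable (proc_space L) (vec_space L)"
    unfolding proc_space_def by (rule measurable_component_singleton) simp
  then have "Measurable.pred (proc_space L) (\<lambda>r. \<forall>l\<in>{1..L}.
      r (vec_norm L z) l + (if l < L then z (l + 1) else 0) = z' l)"
    by (rule measurable_compose) (simp add: vec_space_eq)
  then show ?thesis unfolding reward_event_def by (rule predE)
qed

text \<open>
The numbers \<open>N\<close> and \<open>a\<close> give a lower bound for the probability of an upward step at all late indices,
which is what makes every \<open>stop_index\<close> finite almost surely.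
\<close>

locale reward_stack = prob_space Q for Q :: "'b measure" +
  fixes L :: nat and p :: "nat \<Rightarrow> int pmf" and \<xi> :: "nat \<Rightarrow> 'b \<Rightarrow> nat \<Rightarrow> nat"
    and N :: nat and a :: real
  assumes indep: "indep_vars (\<lambda>n. vec_space (L + 1)) \<xi> {1..}"
    and basis_valued: "\<And>n w. n \<ge> 1 \<Longrightarrow> w \<in> space Q \<Longrightarrow> \<xi> n w \<in> basis_vec (L + 1) ` {1..L + 1}"
    and law_down: "\<And>n l. n \<ge> 1 \<Longrightarrow> l \<in> {1..L} \<Longrightarrow>
        prob {w \<in> space Q. \<xi> n w = basis_vec (L + 1) l} = pmf (p n) (- int l)"
    and law_up: "\<And>n. n \<ge> 1 \<Longrightarrow> prob {w \<in> space Q. \<xi> n w = basis_vec (L + 1) (L + 1)} = pmf (p n) 1"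
    and up_eventually: "a > 0" "\<And>n. n \<ge> N \<Longrightarrow> pmf (p n) 1 \<ge> a"
begin

lemma \<xi>_measurable: "n \<ge> 1 \<Longrightarrow> \<xi> n \<in> measurable Q (vec_space (L + 1))"
  using indep by (simp add: indep_vars_def)

text \<open>
The step that a basis vector stands for. On the \<open>l\<close>-th basis vector with \<open>l \<le> L\<close> the weighted sum picks
out the index \<open>l\<close>.
\<close>

definition decode :: "(nat \<Rightarrow> nat) \<Rightarrow> int" where
  "decode e = (if e (L + 1) = 1 then 1 else - int (\<Sum>l\<in>{1..L}. l * e l))"

lemma decode_basis_vec:
  "decode (basis_vec (L + 1) (L + 1)) = 1"
  "l \<in> {1..L} \<Longrightarrow> decode (basis_vec (L + 1) l) = - int l"
proof -
  show "decode (basis_vec (L + 1) (L + 1)) = 1" by (simp add: decode_def basis_vec_def)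
  assume l: "l \<in> {1..L}"
  have "(\<Sum>l'\<in>{1..L}. l' * basis_vec (L + 1) l l') = (\<Sum>l'\<in>{1..L}. if l' = l then l' else 0)"
    by (intro sum.cong) (auto simp: basis_vec_def)
  with l show "decode (basis_vec (L + 1) l) = - int l"
    by (simp add: decode_def basis_vec_def)
qed

definition step_at :: "nat \<Rightarrow> 'b \<Rightarrow> int" where
  "step_at n w = decode (\<xi> n w)"

lemma basis_cases:
  assumes "n \<ge> 1" "w \<in> space Q"
  obtains "\<xi> n w = basis_vec (L + 1) (L + 1)" "step_at n w = 1"
  | l where "l \<in> {1..L}" "\<xi> n w = basis_vec (L + 1) l" "step_at n w = - int l"
proof -
  obtain l where l: "l \<in> {1..L + 1}" "\<xi> n w = basis_vec (L + 1) l"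
    using basis_valued[OF assms] by blast
  show ?thesis
  proof (cases "l = L + 1")
    case True
    with l that(1) show ?thesis by (simp add: step_at_def decode_basis_vec[simplified] decode_basis_vec)
  next
    case False
    with l have "l \<in> {1..L}" by auto
    with l that(2)[of l] show ?thesis by (simp add: step_at_def decode_basis_vec[simplified] decode_basis_vec)
  qed
qed

lemma step_at_facts:
  assumes "n \<ge> 1" "w \<in> space Q"
  shows "step_at n w \<in> steps L"
    and "\<xi> n w (L + 1) = of_bool (step_at n w = 1)"
    and "l \<in> {1..L} \<Longrightarrow> \<xi> n w l = of_bool (step_at n w = - int l)"
    and "step_at n w = 1 \<longleftrightarrow> \<xi> n w = basis_vec (L + 1) (L + 1)"
    and "l \<in> {1..L} \<Longrightarrow> step_at n w = - int l \<longleftrightarrow> \<xi> n w = basis_vec (L + 1) l"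
proof -
  from assms show "step_at n w \<in> steps L"
    by (cases rule: basis_cases) (auto simp: steps_def)
  from assms show "\<xi> n w (L + 1) = of_bool (step_at n w = 1)"
    by (cases rule: basis_cases) (auto simp: basis_vec_def)
  from assms show "\<xi> n w l = of_bool (step_at n w = - int l)" if "l \<in> {1..L}"
    by (cases rule: basis_cases) (use that in \<open>auto simp: basis_vec_def\<close>)
  have "\<xi> n w = basis_vec (L + 1) (L + 1)" if "step_at n w = 1"
    using assms by (cases rule: basis_cases) (use that in auto)
  then show "step_at n w = 1 \<longleftrightarrow> \<xi> n w = basis_vec (L + 1) (L + 1)"
    by (auto simp: step_at_def decode_basis_vec[simplified] decode_basis_vec)
  have "\<xi> n w = basis_vec (L + 1) l" if "step_at n w = - int l" "l \<in> {1..L}"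
    using assms by (cases rule: basis_cases) (use that in auto)
  then show "step_at n w = - int l \<longleftrightarrow> \<xi> n w = basis_vec (L + 1) l" if "l \<in> {1..L}"
    using that by (auto simp: step_at_def decode_basis_vec[simplified] decode_basis_vec)
qed

lemma prob_step_at:
  assumes "n \<ge> 1" "i \<in> steps L"
  shows "prob {w \<in> space Q. step_at n w = i} = pmf (p n) i"
  using assms(2)
proof (cases rule: steps_cases)
  case 1
  then have "{w \<in> space Q. step_at n w = i} = {w \<in> space Q. \<xi> n w = basis_vec (L + 1) (L + 1)}"
    using step_at_facts(4)[OF assms(1)] by auto
  with law_up[OF assms(1)] 1 show ?thesis by simp
next
  case (2 l)
  then have "{w \<in> space Q. step_at n w = i} = {w \<in> space Q. \<xi> n w = basis_vec (L + 1) l}"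
    using step_at_facts(5)[OF assms(1)] by auto
  with law_down[OF assms(1) 2(1)] 2 show ?thesis by simp
qed

lemma indep_step_at: "indep_vars (\<lambda>_. count_space UNIV) step_at {1..}"
  unfolding step_at_def[abs_def]
  by (rule indep_vars_compose2[OF indep]) (auto simp: vec_space_eq)

lemma step_at_measurable: "n \<ge> 1 \<Longrightarrow> step_at n \<in> measurable Q (count_space UNIV)"
  using indep_step_at by (simp add: indep_vars_def)

lemma prob_step_at_Collect:
  assumes "finite J" "J \<subseteq> {1..}"
  shows "prob {w \<in> space Q. \<forall>j\<in>J. step_at j w \<in> B j} = (\<Prod>j\<in>J. prob {w \<in> space Q. step_at j w \<in> B j})"
proof (cases "J = {}")
  case True
  then show ?thesis by (simp add: prob_space)
next
  case False
  then have "prob (\<Inter>j\<in>J. step_at j -` B j \<inter> space Q) = (\<Prod>j\<in>J. prob (step_at j -` B j \<inter> space Q))"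
    using assms by (intro indep_varsD[OF indep_step_at]) auto
  moreover have "(\<Inter>j\<in>J. step_at j -` B j \<inter> space Q) = {w \<in> space Q. \<forall>j\<in>J. step_at j w \<in> B j}"
    using False by auto
  moreover have "step_at j -` B j \<inter> space Q = {w \<in> space Q. step_at j w \<in> B j}" for j by auto
  ultimately show ?thesis by simp
qed

definition word :: "nat \<Rightarrow> 'b \<Rightarrow> int list" where
  "word n w = map (\<lambda>j. step_at (Suc j) w) [0..<n]"

lemma word_Suc: "word (Suc n) w = word n w @ [step_at (Suc n) w]"
  by (simp add: word_def)

lemma length_word [simp]: "length (word n w) = n"
  by (simp add: word_def)

lemma word_prefix: "m \<le> n \<Longrightarrow> prefix (word m w) (word n w)"
  by (induction n) (auto simp: le_Suc_eq word_Suc)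

lemma count_word: "count_list (word n w) i = (\<Sum>j\<in>{1..n}. of_bool (step_at j w = i))"
proof (induction n)
  case (Suc n)
  then show ?case by (simp add: word_Suc del: sum_of_bool_eq)
qed (simp add: word_def)

lemma word_eq_iff: "word (length d) w = d \<longleftrightarrow> (\<forall>j\<in>{1..length d}. step_at j w \<in> {d ! (j - 1)})"
proof -
  have "word (length d) w = d \<longleftrightarrow> (\<forall>j<length d. step_at (Suc j) w = d ! j)"
    unfolding word_def by (subst list_eq_iff_nth_eq) simp
  also have "\<dots> \<longleftrightarrow> (\<forall>j\<in>Suc ` {..<length d}. step_at j w \<in> {d ! (j - 1)})"
    unfolding ball_simps by auto
  finally show ?thesis unfolding image_Suc_lessThan .
qed

lemma prob_word:
  assumes "set d \<subseteq> steps L"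
  shows "prob {w \<in> space Q. word (length d) w = d} = completion_weight p d []"
proof -
  have "prob {w \<in> space Q. word (length d) w = d} =
      (\<Prod>j\<in>{1..length d}. prob {w \<in> space Q. step_at j w \<in> {d ! (j - 1)}})"
    unfolding word_eq_iff by (rule prob_step_at_Collect) auto
  also have "\<dots> = (\<Prod>j\<in>{1..length d}. pmf (p j) (d ! (j - 1)))"
  proof (intro prod.cong refl)
    fix j assume j: "j \<in> {1..length d}"
    then have "d ! (j - 1) \<in> steps L" using assms nth_mem[of "j - 1" d] by auto
    then show "prob {w \<in> space Q. step_at j w \<in> {d ! (j - 1)}} = pmf (p j) (d ! (j - 1))"
      using prob_step_at[of j "d ! (j - 1)"] j by simp
  qed
  also have "\<dots> = (\<Prod>j<length d. pmf (p (Suc j)) (d ! j))"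
    unfolding One_nat_def prod.atLeast1_atMost_eq by simp
  finally show ?thesis by (simp add: completion_weight_Nil)
qed

lemma word_measurable:
  "{w \<in> space Q. word (length d) w = d} \<in> sets Q"
proof -
  have "{w \<in> space Q. step_at j w \<in> {d ! (j - 1)}} \<in> sets Q" if "j \<in> {1..length d}" for j
    using measurable_sets[OF step_at_measurable, of j "{d ! (j - 1)}"] that
    by (simp add: vimage_def Int_def conj_commute)
  then show ?thesis unfolding word_eq_iff by (intro sets.sets_Collect_finite_All) auto
qed

text \<open>
By independence, \<open>k\<close> consecutive late indices are all free of upward steps with probability at most
\<open>(1 - a) ^ k\<close>.
\<close>

lemma AE_infinitely_many_ups: "AE w in Q. \<forall>n. \<exists>j>n. step_at j w = 1"
  unfolding AE_all_countable
proof
  fix n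
  let ?E = "{w \<in> space Q. \<forall>j>n. step_at j w \<noteq> 1}"
  let ?J = "\<lambda>k. {Suc (n + N)..n + N + k}"
  have meas: "{w \<in> space Q. step_at j w \<in> - {1}} \<in> sets Q" if "j \<ge> 1" for j
    using measurable_sets[OF step_at_measurable[OF that], of "- {1}"]
    by (simp add: vimage_def Int_def conj_commute)
  have "{w \<in> space Q. j > n \<longrightarrow> step_at j w \<noteq> 1} \<in> sets Q" for j
    using meas[of j] by (cases "j > n") auto
  then have E: "?E \<in> sets Q" by (intro sets.sets_Collect_countable_All)
  have "prob ?E \<le> (1 - a) ^ k" for k
  proof -
    have "prob ?E \<le> prob {w \<in> space Q. \<forall>j\<in>?J k. step_at j w \<in> - {1}}"
      using meas by (intro finite_measure_mono sets.sets_Collect_finite_All) auto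
    also have "\<dots> = (\<Prod>j\<in>?J k. prob {w \<in> space Q. step_at j w \<in> - {1}})"
      by (rule prob_step_at_Collect) auto
    also have "\<dots> \<le> (\<Prod>j\<in>?J k. 1 - a)"
    proof (intro prod_mono conjI measure_nonneg)
      fix j assume j: "j \<in> ?J k"
      have "{w \<in> space Q. step_at j w \<in> - {1}} = space Q - {w \<in> space Q. step_at j w = 1}" by auto
      moreover have "{w \<in> space Q. step_at j w = 1} \<in> sets Q"
        using measurable_sets[OF step_at_measurable, of j "{1}"] j
        by (simp add: vimage_def Int_def conj_commute)
      ultimately have "prob {w \<in> space Q. step_at j w \<in> - {1}} = 1 - pmf (p j) 1"
        using j by (simp add: prob_compl prob_step_at steps_def)
      then show "prob {w \<in> space Q. step_at j w \<in> - {1}} \<le> 1 - a"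
        using up_eventually(2)[of j] j by simp
    qed
    finally show ?thesis by simp
  qed
  moreover have "(\<lambda>k. (1 - a) ^ k) \<longlonglongrightarrow> 0"
    using up_eventually(1) up_eventually(2)[of N] pmf_le_1[of "p N" 1]
    by (intro LIMSEQ_power_zero) auto
  ultimately have "prob ?E \<le> 0"
    by (intro LIMSEQ_le_const) auto
  then have "prob ?E = 0" by (simp add: measure_le_0_iff)
  then have "AE w in Q. w \<notin> ?E" by (simp only: prob_eq_0[OF E])
  then show "AE w in Q. \<exists>j>n. step_at j w = 1"
    using AE_space by eventually_elim blast
qed

text \<open>
The number of upward steps grows by at most one per letter, so it skips no value.
\<close>

lemma ups_reach_every_level:
  assumes "\<forall>n. \<exists>j>n. step_at j w = 1"
  shows "\<exists>n. count_list (word n w) 1 = m"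
proof (induction m)
  case 0
  show ?case by (rule exI[of _ 0]) (simp add: word_def)
next
  case (Suc m)
  then obtain n where n: "count_list (word n w) 1 = m" by blast
  obtain j where "j > n" "step_at j w = 1" using assms by blast
  then have "\<exists>k. step_at (Suc (n + k)) w = 1"
    by (metis less_imp_Suc_add)
  then obtain k where k: "step_at (Suc (n + k)) w = 1" "\<And>i. i < k \<Longrightarrow> step_at (Suc (n + i)) w \<noteq> 1"
    using exists_least_iff[of "\<lambda>k. step_at (Suc (n + k)) w = 1"] by blast
  have "count_list (word (n + i) w) 1 = m" if "i \<le> k" for i
    using that by (induction i) (auto simp: n word_Suc k(2))
  with k(1) have "count_list (word (Suc (n + k)) w) 1 = Suc m" by (simp add: word_Suc)
  then show ?case by blast
qed

lemma stop_index_eq: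
  assumes "w \<in> space Q"
  shows "stop_index L \<xi> m w = (if \<exists>n. n \<ge> 1 \<and> count_list (word n w) 1 = m + 1
     then enat (LEAST n. n \<ge> 1 \<and> count_list (word n w) 1 = m + 1) else \<infinity>)"
proof -
  have "(\<Sum>i\<in>{1..n}. \<xi> i w (L + 1)) = count_list (word n w) 1" for n
    unfolding count_word using step_at_facts(2)[OF _ assms] by (intro sum.cong) auto
  then show ?thesis unfolding stop_index_def by (simp only: Inf_enat_Collect)
qed

text \<open>
The stopped sequence of decoded steps is the word that yields the reward. By minimality of the
stopping index its last letter is an upward step.
\<close>

lemma reward_process_word:
  assumes w: "w \<in> space Q" and ups: "\<forall>n. \<exists>j>n. step_at j w = 1"
  shows "\<exists>T. word T w \<in> stopped_words L z
     (\<lambda>l. reward_process L \<xi> w (vec_norm L z) l + (if l < L then z (l + 1) else 0))"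
proof -
  let ?m = "vec_norm L z"
  let ?S = "\<lambda>n. n \<ge> 1 \<and> count_list (word n w) 1 = ?m + 1"
  obtain n where n: "count_list (word n w) 1 = ?m + 1" using ups_reach_every_level[OF ups] by blast
  then have "n \<noteq> 0" by (cases n) (auto simp: word_def)
  with n have ex: "\<exists>n. ?S n" by (intro exI[of _ n]) simp
  define T where "T = (LEAST n. ?S n)"
  have T: "?S T" unfolding T_def using ex by (rule LeastI_ex)
  have least: "\<not> ?S n" if "n < T" for n using that unfolding T_def by (rule not_less_Least)
  have "stop_index L \<xi> ?m w = enat T" unfolding stop_index_eq[OF w] T_def using ex by simp
  then have "{i. 1 \<le> i \<and> enat i \<le> stop_index L \<xi> ?m w} = {1..T}" by auto
  then have down: "reward_process L \<xi> w ?m l = count_list (word T w) (- int l)" if "l \<in> {1..L}" for l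
    unfolding count_word using that step_at_facts(3)[OF _ w that]
    by (simp add: reward_process_def del: sum_of_bool_eq)
  obtain T' where T': "T = Suc T'" using T by (cases T) auto
  have "step_at T w = 1"
  proof (rule ccontr)
    assume "step_at T w \<noteq> 1"
    then have "count_list (word T' w) 1 = ?m + 1" using T by (simp add: T' word_Suc)
    moreover from this have "T' \<noteq> 0" by (cases T') (auto simp: word_def)
    ultimately show False using least[of T'] T' by simp
  qed
  then have "last (word T w) = 1" by (simp add: T' word_Suc)
  moreover have "set (word T w) \<subseteq> steps L"
    using step_at_facts(1)[OF _ w] by (auto simp: word_def)
  ultimately have "word T w \<in> stopped_words L z
     (\<lambda>l. reward_process L \<xi> w ?m l + (if l < L then z (l + 1) else 0))"
    using T down by (simp add: stopped_words_def)
  then show ?thesis ..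
qed

lemma reward_process_measurable: "reward_process L \<xi> \<in> measurable Q (proc_space L)"
  unfolding proc_space_def
proof (rule measurable_PiM_single')
  fix m
  show "(\<lambda>w. reward_process L \<xi> w m) \<in> measurable Q (vec_space L)"
    unfolding vec_space_def
  proof (rule measurable_PiM_single')
    fix l assume l: "l \<in> {1..L}"
    have coord: "(\<lambda>w. \<xi> i w j) \<in> measurable Q (count_space UNIV)" if "i \<ge> 1" for i j
      using \<xi>_measurable[OF that] by (rule measurable_compose) (simp add: vec_space_eq)
    have sums: "(\<lambda>w. \<Sum>i\<in>{1..k}. \<xi> i w j) \<in> measurable Q (count_space UNIV)" for k j
      by (intro measurable_sum_nat coord) simp
    let ?S = "\<lambda>w n. n \<ge> 1 \<and> (\<Sum>i\<in>{1..n}. \<xi> i w (L + 1)) = m + 1"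
    have S: "Measurable.pred Q (\<lambda>w. ?S w n)" for n
      by (rule measurable_compose[OF sums[of "L + 1" n]]) simp
    have eq: "reward_process L \<xi> w m l =
        (if \<exists>n. ?S w n then \<Sum>i\<in>{1..LEAST n. ?S w n}. \<xi> i w l else 0)" for w
    proof (cases "\<exists>n. ?S w n")
      case True
      then have "{i. 1 \<le> i \<and> enat i \<le> stop_index L \<xi> m w} = {1..LEAST n. ?S w n}"
        unfolding stop_index_def Inf_enat_Collect by auto
      with True l show ?thesis by (simp only: reward_process_def restrict_apply' if_True)
    next
      case False
      then have "{i. 1 \<le> i \<and> enat i \<le> stop_index L \<xi> m w} = {1..}"
        unfolding stop_index_def Inf_enat_Collect by auto
      with False l show ?thesis
        by (simp only: reward_process_def restrict_apply' if_False sum.infinite infinite_Ici not_False_eq_True)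
    qed
    have ex: "Measurable.pred Q (\<lambda>w. \<exists>n. ?S w n)"
      by (rule pred_intros_countable(2)[OF S])
    have T: "(\<lambda>w. LEAST n. ?S w n) \<in> measurable Q (count_space UNIV)"
      by (rule measurable_Least[OF S])
    have val: "(\<lambda>w. \<Sum>i\<in>{1..LEAST n. ?S w n}. \<xi> i w l) \<in> measurable Q (count_space UNIV)"
      using measurable_compose_countable[of "\<lambda>k w. \<Sum>i\<in>{1..k}. \<xi> i w l", OF sums T] .
    show "(\<lambda>w. reward_process L \<xi> w m l) \<in> measurable Q (count_space UNIV)"
      unfolding eq by (rule measurable_If[OF val measurable_count_space_const predE[OF ex]])
  qed (auto simp: reward_process_def)
next
  have "reward_process L \<xi> w m \<in> space (vec_space L)" for w m
    by (simp add: reward_process_def vec_space_eq PiE_iff)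
  then show "reward_process L \<xi> \<in> space Q \<rightarrow> UNIV \<rightarrow>\<^sub>E space (vec_space L)" by auto
qed

text \<open>
Up to a null set the event says that the step sequence begins with some word in
\<open>stopped_words L z z'\<close>; these alternatives are disjoint because stopped words form a prefix code.
\<close>

lemma prob_reward_event:
  "measure (distr Q (proc_space L) (reward_process L \<xi>)) (reward_event L z z') =
   transition_weight L p z z'"
proof -
  let ?E = "reward_process L \<xi> -` reward_event L z z' \<inter> space Q"
  have E: "?E \<in> sets Q"
    using reward_process_measurable sets_reward_event by (rule measurable_sets)
  let ?D = "stopped_words L z z'"
  let ?W = "\<lambda>d. {w \<in> space Q. word (length d) w = d}"
  let ?r = "\<lambda>w l. reward_process L \<xi> w (vec_norm L z) l + (if l < L then z (l + 1) else 0)"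
  have comparable: "prefix c d \<or> prefix d c" if "word (length c) w = c" "word (length d) w = d" for c d w
    using word_prefix[of "length c" "length d" w] word_prefix[of "length d" "length c" w] that
    by (metis nat_le_linear)
  have unique: "c = d" if "c \<in> stopped_words L z x" "d \<in> stopped_words L z y"
    "word (length c) w = c" "word (length d) w = d" for c d w x y
    using comparable[OF that(3,4)] stopped_words_prefix_eq[OF that(1,2)]
      stopped_words_prefix_eq[OF that(2,1)] by auto
  have "AE w in Q. w \<in> ?E \<longleftrightarrow> w \<in> (\<Union>d\<in>?D. ?W d)"
    using AE_infinitely_many_ups AE_space
  proof eventually_elim
    case (elim w)
    obtain T where T: "word T w \<in> stopped_words L z (?r w)"
      using reward_process_word[OF elim(2,1)] by blast
    show ?case
    proof
      assume "w \<in> ?E"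
      then have "stopped_words L z (?r w) = ?D"
        by (intro stopped_words_cong) (auto simp: reward_event_def)
      with T elim(2) show "w \<in> (\<Union>d\<in>?D. ?W d)" by (auto intro!: bexI[of _ "word T w"])
    next
      assume "w \<in> (\<Union>d\<in>?D. ?W d)"
      then obtain d where d: "d \<in> ?D" "word (length d) w = d" by auto
      with T have "word T w = d" by (intro unique[OF T d(1)]) auto
      with T have "d \<in> stopped_words L z (?r w)" by simp
      then have "?r w l = z' l" if "l \<in> {1..L}" for l
        by (rule stopped_words_target_unique[OF _ d(1) that])
      with elim(2) show "w \<in> ?E"
        using measurable_space[OF reward_process_measurable, of w] by (simp add: reward_event_def)
    qed
  qed
  then have E_words: "prob ?E = prob (\<Union>d\<in>?D. ?W d)"
    using word_measurable E
    by (intro finite_measure_eq_AE) (auto intro!: sets.finite_UN simp: finite_stopped_words)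
  have words: "prob (\<Union>d\<in>?D. ?W d) = (\<Sum>d\<in>?D. prob (?W d))"
  proof (rule finite_measure_finite_Union)
    show "disjoint_family_on ?W ?D" using unique by (fastforce simp: disjoint_family_on_def)
  qed (use word_measurable in \<open>auto simp: finite_stopped_words\<close>)
  have "(\<Sum>d\<in>?D. prob (?W d)) = transition_weight L p z z'"
    unfolding transition_weight_def by (intro sum.cong refl prob_word) (auto simp: stopped_words_def)
  then show ?thesis
    by (simp only: measure_distr[OF reward_process_measurable sets_reward_event] E_words words)
qed

end

section \<open>The law of the branching process\<close>

lemma branching_process_measurable:
  assumes Z0: "Z0 \<in> measurable R (vec_space L)"
    and A: "\<And>j. j \<ge> 1 \<Longrightarrow> A j \<in> measurable R (proc_space L)"
  shows "branching_process L Z0 A k \<in> measurable R (vec_space L)"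
proof (induction k)
  case 0
  have "branching_process L Z0 A 0 = Z0" by (rule ext) simp
  then show ?case using Z0 by simp
next
  case (Suc k)
  let ?Z = "branching_process L Z0 A k"
  have "(\<lambda>w. (?Z w, A (Suc k) w (vec_norm L (?Z w)))) \<in>
      measurable R (vec_space L \<Otimes>\<^sub>M vec_space L)"
  proof (rule measurable_Pair[OF Suc])
    have "(\<lambda>w. A (Suc k) w m) \<in> measurable R (vec_space L)" for m
      using measurable_component_singleton[of m UNIV "\<lambda>_. vec_space L"]
      by (intro measurable_compose[OF A[of "Suc k"]]) (auto simp: proc_space_def)
    moreover have "(\<lambda>w. vec_norm L (?Z w)) \<in> measurable R (count_space UNIV)"
      using Suc by (rule measurable_compose) (simp add: vec_space_eq)
    ultimately show "(\<lambda>w. A (Suc k) w (vec_norm L (?Z w))) \<in> measurable R (vec_space L)"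
      by (rule measurable_compose_countable)
  qed
  moreover have "vec_space L \<Otimes>\<^sub>M vec_space L =
      count_space ((\<Pi>\<^sub>E l\<in>{1..L}. UNIV) \<times> (\<Pi>\<^sub>E l\<in>{1..L}. UNIV))"
    unfolding vec_space_eq by (intro pair_measure_countable countable_PiE) auto
  moreover have "branching_process L Z0 A (Suc k) =
      (\<lambda>(z, r). \<lambda>l\<in>{1..L}. r l + (if l < L then z (l + 1) else 0)) \<circ>
      (\<lambda>w. (?Z w, A (Suc k) w (vec_norm L (?Z w))))"
    by (rule ext) simp
  ultimately show ?case
    by (simp only:) (rule measurable_comp, assumption, auto simp: vec_space_eq)
qed

lemma branching_process_extensional:
  assumes "Z0 w \<in> extensional {1..L}"
  shows "branching_process L Z0 A k w \<in> extensional {1..L}"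
  using assms by (cases k) simp_all

text \<open>
Given the values \<open>z 0, \<dots>, z (k - 1)\<close>, the equation for the \<open>k\<close>-th value constrains only the copy \<open>A k\<close>,
and at a deterministic argument. The event is therefore an intersection of independent events.
\<close>

lemma prob_branching_process:
  fixes z :: "nat \<Rightarrow> nat \<Rightarrow> nat"
  assumes R: "prob_space R"
    and A: "prob_space.indep_vars R (\<lambda>_. proc_space L) A {1..}"
    and law: "\<And>j y y'. j \<ge> 1 \<Longrightarrow>
      measure (distr R (proc_space L) (A j)) (reward_event L y y') = transition_weight L p y y'"
    and Z0: "Z0 \<in> measurable R (vec_space L)" "AE w in R. \<forall>l\<in>{1..L}. Z0 w l = 0"
    and n: "n \<ge> 1" and z: "\<And>k. k < n \<Longrightarrow> z k \<in> extensional {1..L}"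
  shows "measure R {w \<in> space R. \<forall>k<n. branching_process L Z0 A k w = z k} =
    of_bool (z 0 = (\<lambda>l\<in>{1..L}. 0)) *
    (\<Prod>k\<in>{1..<n}. transition_weight L p (z (k - 1)) (z k))"
proof -
  interpret prob_space R by (rule R)
  let ?Z = "branching_process L Z0 A"
  let ?E = "{w \<in> space R. \<forall>k<n. ?Z k w = z k}"
  let ?G = "\<lambda>j. reward_event L (z (j - 1)) (z j)"
  have A_meas: "A j \<in> measurable R (proc_space L)" if "j \<ge> 1" for j
    using A that by (simp add: indep_vars_def)
  have zero: "AE w in R. Z0 w = (\<lambda>l\<in>{1..L}. 0)"
    using Z0(2) AE_space
  proof eventually_elim
    case (elim w)
    then have "Z0 w \<in> extensional {1..L}"
      using measurable_space[OF Z0(1), of w] by (simp add: vec_space_eq PiE_iff)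
    with elim(1) show ?case by (auto intro: extensionalityI)
  qed
  show ?thesis
  proof (cases "z 0 = (\<lambda>l\<in>{1..L}. 0)")
    case False
    have "AE w in R. \<not> (\<forall>k<n. ?Z k w = z k)"
      using zero
    proof eventually_elim
      case (elim w)
      then have "?Z 0 w \<noteq> z 0" using False by (simp only: branching_process.simps not_False_eq_True)
      then show ?case using n by (metis less_le_trans zero_less_one)
    qed
    then have "prob ?E = 0" by (rule prob_eq_0_AE)
    then show ?thesis using False by (simp only: of_bool_eq mult_zero_left)
  next
    case True
    have steps_iff: "(\<forall>k<n. ?Z k w = z k) \<longleftrightarrow> (\<forall>j\<in>{1..<n}. A j w \<in> ?G j)"
      if w: "w \<in> space R" and start: "Z0 w = (\<lambda>l\<in>{1..L}. 0)" for w
    proof -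
      have step: "?Z j w = z j \<longleftrightarrow> A j w \<in> ?G j" if j: "j \<in> {1..<n}" and "?Z (j - 1) w = z (j - 1)" for j
      proof -
        obtain i where i: "j = Suc i" using j by (cases j) auto
        have "A j w \<in> space (proc_space L)"
          using measurable_space[OF A_meas w] j by simp
        then have "A j w \<in> ?G j \<longleftrightarrow> (\<forall>l\<in>{1..L}. ?Z j w l = z j l)"
          using that(2) by (simp add: reward_event_def i)
        also have "\<dots> \<longleftrightarrow> ?Z j w = z j"
          using z[of j] j branching_process_extensional[of Z0 w L A j] start
          by (auto intro: extensionalityI)
        finally show ?thesis ..
      qed
      show ?thesis
      proof
        assume "\<forall>k<n. ?Z k w = z k"
        then show "\<forall>j\<in>{1..<n}. A j w \<in> ?G j" using step by auto
      next
        assume G: "\<forall>j\<in>{1..<n}. A j w \<in> ?G j"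
        have "?Z k w = z k" if "k < n" for k
          using that
        proof (induction k)
          case 0
          show ?case by (simp only: branching_process.simps True start)
        next
          case (Suc k)
          then show ?case using step[of "Suc k"] G[rule_format, of "Suc k"]
            by (simp del: branching_process.simps)
        qed
        then show "\<forall>k<n. ?Z k w = z k" by blast
      qed
    qed
    have sets_Z: "{w \<in> space R. ?Z k w = z k} \<in> sets R" for k
    proof (rule predE)
      show "Measurable.pred R (\<lambda>w. ?Z k w = z k)"
        using branching_process_measurable[OF Z0(1) A_meas]
        by (rule measurable_compose) (auto simp: vec_space_eq)
    qed
    have sets_A: "A j -` ?G j \<inter> space R \<in> sets R" if "j \<ge> 1" for j
      using A_meas[OF that] sets_reward_event by (rule measurable_sets)
    have sets_G: "{w \<in> space R. A j w \<in> ?G j} \<in> sets R" if "j \<in> {1..<n}" for j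
    proof -
      have "{w \<in> space R. A j w \<in> ?G j} = A j -` ?G j \<inter> space R" by blast
      then show ?thesis using sets_A[of j] that by (simp only: atLeastLessThan_iff)
    qed
    have "prob ?E = prob {w \<in> space R. \<forall>j\<in>{1..<n}. A j w \<in> ?G j}"
    proof (rule finite_measure_eq_AE)
      show "AE w in R. w \<in> ?E \<longleftrightarrow> w \<in> {w \<in> space R. \<forall>j\<in>{1..<n}. A j w \<in> ?G j}"
        using zero AE_space by eventually_elim (simp only: mem_Collect_eq steps_iff)
      have "?E = {w \<in> space R. \<forall>k\<in>{..<n}. ?Z k w = z k}" by auto
      also have "\<dots> \<in> sets R"
        by (intro sets.sets_Collect_finite_All sets_Z finite_lessThan)
      finally show "?E \<in> sets R" .
      show "{w \<in> space R. \<forall>j\<in>{1..<n}. A j w \<in> ?G j} \<in> sets R"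
        by (intro sets.sets_Collect_finite_All sets_G finite_atLeastLessThan)
    qed
    also have "\<dots> = (\<Prod>j\<in>{1..<n}. prob (A j -` ?G j \<inter> space R))"
    proof (cases "{1..<n} = {}")
      case True
      then show ?thesis by (simp add: prob_space)
    next
      case False
      have "{w \<in> space R. \<forall>j\<in>{1..<n}. A j w \<in> ?G j} = (\<Inter>j\<in>{1..<n}. A j -` ?G j \<inter> space R)"
        using False by auto
      then show ?thesis
        using False sets_reward_event by (simp only:) (intro indep_varsD[OF A], auto)
    qed
    also have "\<dots> = (\<Prod>j\<in>{1..<n}. transition_weight L p (z (j - 1)) (z j))"
    proof (rule prod.cong[OF refl])
      fix j assume "j \<in> {1..<n}"
      then have j: "j \<ge> 1" by simp
      show "prob (A j -` ?G j \<inter> space R) = transition_weight L p (z (j - 1)) (z j)"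
        using law[OF j, of "z (j - 1)" "z j"] measure_distr[OF A_meas[OF j] sets_reward_event] by simp
    qed
    finally show ?thesis using True by (simp only: of_bool_eq mult_1_left simp_thms)
  qed
qed

text \<open>
Without upward steps the mean of \<open>\<nu>\<close> would be at most \<open>-1\<close>.
\<close>

lemma pmf_up_pos:
  assumes "set_pmf \<nu> \<subseteq> steps L" "measure_pmf.expectation \<nu> real_of_int = 0"
  shows "pmf \<nu> 1 > 0"
proof (rule ccontr)
  assume "\<not> pmf \<nu> 1 > 0"
  then have up: "pmf \<nu> 1 = 0" by (simp add: pmf_nonneg order_less_le)
  have "0 = (\<Sum>i\<in>steps L. real_of_int i * pmf \<nu> i)"
    unfolding assms(2)[symmetric] using assms(1) by (intro integral_measure_pmf_real) auto
  also have "\<dots> \<le> (\<Sum>i\<in>steps L. - pmf \<nu> i)"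
  proof (rule sum_mono)
    fix i assume "i \<in> steps L"
    show "real_of_int i * pmf \<nu> i \<le> - pmf \<nu> i"
    proof (cases "i = 1")
      case False
      with \<open>i \<in> steps L\<close> have "real_of_int i \<le> - 1" by (simp add: steps_def)
      from mult_right_mono[OF this pmf_nonneg[of \<nu> i]] show ?thesis by simp
    qed (simp add: up)
  qed
  also have "\<dots> = - 1" using sum_pmf_eq_1[of "steps L" \<nu>] assms(1) by (simp add: sum_negf)
  finally show False by simp
qed

section \<open>Equality of the two laws\<close>

lemma PiM_vec_space_eq:
  "(\<Pi>\<^sub>M k\<in>{..<n::nat}. vec_space L) = count_space (\<Pi>\<^sub>E k\<in>{..<n}. \<Pi>\<^sub>E l\<in>{1..L}. UNIV)"
  using count_space_PiM_finite[of "{..<n}" "\<lambda>_. \<Pi>\<^sub>E l\<in>{1..L}. (UNIV :: nat set)"]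
  by (simp add: vec_space_eq comp_def countable_PiE)

lemma distr_vec_sequence_eqI:
  assumes P: "prob_space P" and R: "prob_space R"
    and f: "\<And>k. k < n \<Longrightarrow> f k \<in> measurable P (vec_space L)"
    and g: "\<And>k. k < n \<Longrightarrow> g k \<in> measurable R (vec_space L)"
    and eq: "\<And>z :: nat \<Rightarrow> nat \<Rightarrow> nat. (\<And>k. k < n \<Longrightarrow> z k \<in> extensional {1..L}) \<Longrightarrow>
      measure P {w \<in> space P. \<forall>k<n. f k w = z k} = measure R {w \<in> space R. \<forall>k<n. g k w = z k}"
  shows "distr P (\<Pi>\<^sub>M k\<in>{..<n}. vec_space L) (\<lambda>w. \<lambda>k\<in>{..<n}. f k w) =
         distr R (\<Pi>\<^sub>M k\<in>{..<n}. vec_space L) (\<lambda>w. \<lambda>k\<in>{..<n}. g k w)"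
    (is "distr P ?N ?f = distr R ?N ?g")
proof -
  interpret P: prob_space P by (rule P)
  interpret R: prob_space R by (rule R)
  let ?S = "\<Pi>\<^sub>E k\<in>{..<n}. \<Pi>\<^sub>E l\<in>{1..L}. (UNIV :: nat set)"
  have N: "?N = count_space ?S" by (rule PiM_vec_space_eq)
  have f_meas: "?f \<in> measurable P ?N" using f by (intro measurable_restrict) auto
  have g_meas: "?g \<in> measurable R ?N" using g by (intro measurable_restrict) auto
  show ?thesis
  proof (rule measure_eqI_countable[where A = ?S])
    show "sets (distr P ?N ?f) = Pow ?S" "sets (distr R ?N ?g) = Pow ?S"
      unfolding sets_distr N by (rule sets_count_space)+
    show "countable ?S" by (intro countable_PiE) auto
    fix z assume z: "z \<in> ?S"
    then have set: "{z} \<in> sets ?N" by (simp add: N)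
    have "?f -` {z} \<inter> space P = {w \<in> space P. \<forall>k<n. f k w = z k}"
      "?g -` {z} \<inter> space R = {w \<in> space R. \<forall>k<n. g k w = z k}"
      using PiE_arb[OF z] by (auto simp: fun_eq_iff)
    moreover have "z k \<in> extensional {1..L}" if "k < n" for k
      using PiE_mem[OF z, of k] that by (simp add: PiE_iff)
    ultimately show "emeasure (distr P ?N ?f) {z} = emeasure (distr R ?N ?g) {z}"
      using eq[of z] by (simp only: emeasure_distr[OF f_meas set] emeasure_distr[OF g_meas set]
          P.emeasure_eq_measure R.emeasure_eq_measure)
  qed
qed

theorem proposition2p1:
  fixes M L n :: nat
    and \<nu> :: "int pmf" and q :: "nat \<Rightarrow> int pmf"
    and P :: "'a measure" and X :: "nat \<Rightarrow> 'a \<Rightarrow> int"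
    and Q :: "'b measure" and \<xi> :: "nat \<Rightarrow> 'b \<Rightarrow> nat \<Rightarrow> nat"
    and R :: "'c measure" and A :: "nat \<Rightarrow> 'c \<Rightarrow> nat \<Rightarrow> nat \<Rightarrow> nat"
    and Z0 :: "'c \<Rightarrow> nat \<Rightarrow> nat"
  assumes "M \<ge> 1" and "L \<ge> 1"
    and "set_pmf \<nu> \<subseteq> steps L"
    and "\<And>j. j \<in> {1..M} \<Longrightarrow> set_pmf (q j) \<subseteq> steps L"
    and "measure_pmf.expectation \<nu> real_of_int = 0"
    and "\<And>j. j \<in> {1..M} \<Longrightarrow> measure_pmf.expectation (q j) real_of_int > 0"
    and "\<And>j. j \<in> {1..M} \<Longrightarrow> pmf (q j) 1 < 1"
    and "excited_random_walk P L M q \<nu> X"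
    and "AE w in P. filterlim (\<lambda>k. X k w) at_top sequentially"
    and "reward_sequence Q L M q \<nu> \<xi>"
    and "prob_space R"
    and "iid_copies R L (distr Q (proc_space L) (reward_process L \<xi>)) A"
    and "indep_initial R L Z0 A"
    and "AE w in R. \<forall>l\<in>{1..L}. Z0 w l = 0"
    and "n \<ge> 1"
  shows "distr P (\<Pi>\<^sub>M k\<in>{..<n}. vec_space L)
           (\<lambda>w. \<lambda>k\<in>{..<n}. down_jumps L X n (int n - 1 - int k) w)
       = distr R (\<Pi>\<^sub>M k\<in>{..<n}. vec_space L)
           (\<lambda>w. \<lambda>k\<in>{..<n}. branching_process L Z0 A k w)"
proof -
  let ?p = "env M q \<nu>"
  have support: "set_pmf (?p (Suc j)) \<subseteq> steps L" for j
    using assms(3,4) by (simp add: env_def)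
  have "excited_walk P L ?p X"
    using assms(8) support
    by (auto simp: excited_random_walk_def excited_walk_def excited_walk_axioms_def)
  then interpret P: excited_walk P L ?p X .
  have "reward_stack Q L ?p \<xi> (Suc M) (pmf \<nu> 1)"
    using assms(10) pmf_up_pos[OF assms(3,5)]
    by (auto simp: reward_sequence_def reward_stack_def reward_stack_axioms_def env_def)
  then interpret Q: reward_stack Q L ?p \<xi> "Suc M" "pmf \<nu> 1" .
  interpret R: prob_space R by (rule assms(11))
  have indep: "R.indep_vars (\<lambda>_. proc_space L) A {1..}"
    and law: "\<And>j. j \<ge> 1 \<Longrightarrow> distr R (proc_space L) (A j) = distr Q (proc_space L) (reward_process L \<xi>)"
    using assms(12) by (auto simp: iid_copies_def)
  have Z0: "Z0 \<in> measurable R (vec_space L)"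
    using assms(13) by (simp add: indep_initial_def)
  have A: "A j \<in> measurable R (proc_space L)" if "j \<ge> 1" for j
    using indep that by (simp add: R.indep_vars_def)
  show ?thesis
  proof (rule distr_vec_sequence_eqI)
    show "prob_space P" "prob_space R" by unfold_locales
    show "down_jumps L X n (int n - 1 - int k) \<in> measurable P (vec_space L)" for k
      by (rule P.down_jumps_measurable)
    show "branching_process L Z0 A k \<in> measurable R (vec_space L)" for k
      by (rule branching_process_measurable[OF Z0 A])
    fix z :: "nat \<Rightarrow> nat \<Rightarrow> nat"
    assume z: "\<And>k. k < n \<Longrightarrow> z k \<in> extensional {1..L}"
    have "measure R {w \<in> space R. \<forall>k<n. branching_process L Z0 A k w = z k} =
      of_bool (z 0 = (\<lambda>l\<in>{1..L}. 0)) *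
      (\<Prod>k\<in>{1..<n}. transition_weight L ?p (z (k - 1)) (z k))"
      by (rule prob_branching_process[OF assms(11) indep _ Z0 assms(14,15) z])
         (simp_all only: law Q.prob_reward_event)
    then show "measure P {w \<in> space P. \<forall>k<n. down_jumps L X n (int n - 1 - int k) w = z k} =
      measure R {w \<in> space R. \<forall>k<n. branching_process L Z0 A k w = z k}"
      by (simp only: P.prob_down_jumps[OF assms(9,15) z])
  qed
qed

end
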